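(* Let $Y\subset\mathcal{A}^{\mathbb{Z}}$ be a subshift on a finite alphabet $\mathcal{A}$ with shift map $S\colon Y\to Y$, and let $\tau\colon Y\to\mathbb{Z}$ be a continuous map which is $\lambda$-unbounded for some $\lambda>0$. Let $(X_1,T_1)$ and $(X_2,T_2)$ be invertible topological dynamical systems and assume that there is a topological factor map from $S\rtimes_\tau T_1$ to $S\rtimes_\tau T_2$. Then $h_{top}(T_1)\ge h_{top}(T_2)$. If in addition $\tau(y)\in\{-1,0,1\}$ for every $y\in Y$, then $\overline{\operatorname{ent}}_{\mathbf{b}}(T_1)\ge\underline{\operatorname{ent}}_{\mathbf{b}}(T_2)$ for every scale $\mathbf{b}$.
   Context: All spaces are nonempty. A topological dynamical system $(X,T)$ is a compact metric space $(X,d)$ with a continuous map $T\colon X\to X$; it is invertible if $T$ is a homeomorphism. A topological factor map is a continuous surjection intertwining the two maps. $h_{top}(T)\in[0,\infty]$ is topological entropy. Subshift: a closed subset $Y\subset\mathcal{A}^{\mathbb{Z}}$ (product topology, $\mathcal{A}$ finite discrete) invariant under the shift $S(y)(n)=y(n+1)$. Skew product: for an invertible system $(X,T)$, $S\rtimes_\tau T\colon Y\times X\to Y\times X$, $(y,x)\mapsto(S(y),T^{\tau(y)}(x))$. $\lambda$-unbounded: since $\tau$ is continuous there is $s\in\mathbb{N}$ such that $\tau(y)$ is determined by $y|_{\{-s,\dots,s\}}$ for all $y\in Y$; fix such $s$. Let $L_{n,s}(Y)=\{y|_{\{-s,\dots,s+n-1\}}:y\in Y\}$. Put $\tau^0(y)=0$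 and $\tau^n(y)=\sum_{i=0}^{n-1}\tau(S^iy)$ for $n\ge1$. For $w\in L_{n,s}(Y)$ and $0\le i\le n-1$ the value $\tau^i(w):=\tau^i(y)$ is the same for all $y\in Y$ restricting to $w$. Let $r_n(w)=|\{\tau^i(w):i=0,\dots,n-1\}|$. For $\lambda>0$, $\tau$ is $\lambda$-unbounded if for every $N\in\mathbb{N}$, $\liminf_{n\to\infty}|\{w\in L_{n,s}(Y):r_n(w)\ge N\}|/|L_{n,s}(Y)|\ge\lambda$. (This does not depend on the choice of $s$.) Scale: a family $\mathbf{a}=\{a_n(t)\}_{n\in\mathbb{N},t>0}$ of positive reals such that for each $t$ the sequence $n\mapsto a_n(t)$ is nondecreasing and tends to infinity, and for each $n$ the function $t\mapsto a_n(t)$ is nondecreasing. Slow entropy: for a system $(Z,R)$ with metric $d$, $\operatorname{spa}(R,\{0,\dots,n-1\},\epsilon)$ is the minimal cardinality of a set $E\subset Z$ such that for all $x\in Z$ there is $y\in E$ with $\max_{0\le i\le n-1}d(R^ix,R^iy)\le\epsilon$. Define $\overline{\operatorname{ent}}_{\mathbf{a}}(R,\epsilon)=\sup(\{0\}\cup\{t>0:\limsup_n \operatorname{spa}(R,\{0,\dots,n-1\},\epsilon)/a_n(t)>0\})$ and $\overline{\operatorname{ent}}_{\mathbf{a}}(R)=\lim_{\epsilon\to0^+}\overline{\operatorname{ent}}_{\mathbf{a}}(R,\epsilon)\in[0,\infty]$; $\underline{\operatorname{ent}}_{\mathbf{a}}$ is defined in the same way with $\liminf$ in place of $\limsup$.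 *)

theory Defs
  imports "HOL-Analysis.Analysis"
begin

section \<open>Topological dynamical systems\<close>

text \<open>A compact metric space is given as a compact subset of a \<open>metric_space\<close> type.\<close>

definition tds :: "'x::metric_space set \<Rightarrow> ('x \<Rightarrow> 'x) \<Rightarrow> bool" where
  "tds X T \<longleftrightarrow> X \<noteq> {} \<and> compact X \<and> continuous_on X T \<and> T ` X \<subseteq> X"

definition invertible_tds :: "'x::metric_space set \<Rightarrow> ('x \<Rightarrow> 'x) \<Rightarrow> bool" where
  "invertible_tds X T \<longleftrightarrow> tds X T \<and> (\<exists>T'. homeomorphism X X T T')"

definition factor_map ::
  "'z::topological_space set \<Rightarrow> ('z \<Rightarrow> 'z) \<Rightarrow> 'w::topological_space set \<Rightarrow> ('w \<Rightarrow> 'w) \<Rightarrow> ('z \<Rightarrow> 'w) \<Rightarrow> bool"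
  where "factor_map Z R W Q \<pi> \<longleftrightarrow>
    continuous_on Z \<pi> \<and> \<pi> ` Z = W \<and> (\<forall>z\<in>Z. \<pi> (R z) = Q (\<pi> z))"

definition int_iterate :: "'x set \<Rightarrow> ('x \<Rightarrow> 'x) \<Rightarrow> int \<Rightarrow> 'x \<Rightarrow> 'x" where
  "int_iterate X T k = (if k \<ge> 0 then T ^^ nat k else inv_into X T ^^ nat (- k))"


section \<open>Spanning numbers, topological entropy and slow entropy\<close>

definition spanning :: "'x::metric_space set \<Rightarrow> ('x \<Rightarrow> 'x) \<Rightarrow> nat set \<Rightarrow> real \<Rightarrow> 'x set \<Rightarrow> bool" where
  "spanning Z R F \<epsilon> E \<longleftrightarrow>
    E \<subseteq> Z \<and> (\<forall>x\<in>Z. \<exists>y\<in>E. \<forall>i\<in>F. dist ((R ^^ i) x) ((R ^^ i) y) \<le> \<epsilon>)"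

text \<open>For a system on a compact space, a finite set \<open>F\<close> of times and \<open>\<epsilon> > 0\<close>, finite spanning
  sets exist, so the minimum is attained.\<close>

definition spa :: "'x::metric_space set \<Rightarrow> ('x \<Rightarrow> 'x) \<Rightarrow> nat set \<Rightarrow> real \<Rightarrow> nat" where
  "spa Z R F \<epsilon> = (LEAST k. \<exists>E. finite E \<and> card E = k \<and> spanning Z R F \<epsilon> E)"

text \<open>Topological entropy is taken in the Bowen--Dinaburg form. In this definition and the next
  ones the quantity under \<open>Lim\<close> is nonincreasing in \<open>\<epsilon>\<close>, so the limit exists in \<open>ereal\<close>.\<close>

definition h_top :: "'x::metric_space set \<Rightarrow> ('x \<Rightarrow> 'x) \<Rightarrow> ereal" where
  "h_top X T =
    Lim (at_right 0) (\<lambda>\<epsilon>. limsup (\<lambda>n. ereal (ln (real (spa X T {..<n} \<epsilon>)) / real n)))"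

definition scale :: "(nat \<Rightarrow> real \<Rightarrow> real) \<Rightarrow> bool" where
  "scale a \<longleftrightarrow>
    (\<forall>t>0. (\<forall>n. a n t > 0) \<and> incseq (\<lambda>n. a n t) \<and> filterlim (\<lambda>n. a n t) at_top sequentially) \<and>
    (\<forall>n. mono_on {0<..} (a n))"

definition upper_ent_at ::
  "(nat \<Rightarrow> real \<Rightarrow> real) \<Rightarrow> 'x::metric_space set \<Rightarrow> ('x \<Rightarrow> 'x) \<Rightarrow> real \<Rightarrow> ereal" where
  "upper_ent_at a Z R \<epsilon> =
    Sup ({0} \<union> ereal ` {t. t > 0 \<and> limsup (\<lambda>n. ereal (real (spa Z R {..<n} \<epsilon>) / a n t)) > 0})"

definition lower_ent_at ::
  "(nat \<Rightarrow> real \<Rightarrow> real) \<Rightarrow> 'x::metric_space set \<Rightarrow> ('x \<Rightarrow> 'x) \<Rightarrow> real \<Rightarrow> ereal" where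
  "lower_ent_at a Z R \<epsilon> =
    Sup ({0} \<union> ereal ` {t. t > 0 \<and> liminf (\<lambda>n. ereal (real (spa Z R {..<n} \<epsilon>) / a n t)) > 0})"

definition upper_ent :: "(nat \<Rightarrow> real \<Rightarrow> real) \<Rightarrow> 'x::metric_space set \<Rightarrow> ('x \<Rightarrow> 'x) \<Rightarrow> ereal" where
  "upper_ent a Z R = Lim (at_right 0) (upper_ent_at a Z R)"

definition lower_ent :: "(nat \<Rightarrow> real \<Rightarrow> real) \<Rightarrow> 'x::metric_space set \<Rightarrow> ('x \<Rightarrow> 'x) \<Rightarrow> ereal" where
  "lower_ent a Z R = Lim (at_right 0) (lower_ent_at a Z R)"


section \<open>Subshifts, cocycles and skew products\<close>

definition shift :: "(int \<Rightarrow> 'a) \<Rightarrow> int \<Rightarrow> 'a" where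
  "shift y = (\<lambda>n. y (n + 1))"

text \<open>The alphabet is a finite discrete type, and \<open>int \<Rightarrow> 'a\<close> carries the product topology of
  \<^theory>\<open>HOL-Analysis.Function_Topology\<close>. Invariance means that the shift maps \<open>Y\<close> into itself;
  equality is not required.\<close>

definition subshift :: "(int \<Rightarrow> 'a::{finite,discrete_topology}) set \<Rightarrow> bool" where
  "subshift Y \<longleftrightarrow> Y \<noteq> {} \<and> closed Y \<and> shift ` Y \<subseteq> Y"

definition skew_product ::
  "((int \<Rightarrow> 'a) \<Rightarrow> int) \<Rightarrow> 'x set \<Rightarrow> ('x \<Rightarrow> 'x) \<Rightarrow> (int \<Rightarrow> 'a) \<times> 'x \<Rightarrow> (int \<Rightarrow> 'a) \<times> 'x" where
  "skew_product \<tau> X T = (\<lambda>(y, x). (shift y, int_iterate X T (\<tau> y) x))"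

definition cocycle_sum :: "((int \<Rightarrow> 'a) \<Rightarrow> int) \<Rightarrow> nat \<Rightarrow> (int \<Rightarrow> 'a) \<Rightarrow> int" where
  "cocycle_sum \<tau> n y = (\<Sum>i<n. \<tau> ((shift ^^ i) y))"

definition determined_by_window :: "(int \<Rightarrow> 'a) set \<Rightarrow> ((int \<Rightarrow> 'a) \<Rightarrow> int) \<Rightarrow> nat \<Rightarrow> bool" where
  "determined_by_window Y \<tau> s \<longleftrightarrow>
    (\<forall>y\<in>Y. \<forall>y'\<in>Y. (\<forall>j\<in>{- int s..int s}. y j = y' j) \<longrightarrow> \<tau> y = \<tau> y')"

definition window_word :: "nat \<Rightarrow> nat \<Rightarrow> (int \<Rightarrow> 'a) \<Rightarrow> int \<Rightarrow> 'a" where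
  "window_word n s y = restrict y {- int s..int s + int n - 1}"

definition language :: "nat \<Rightarrow> nat \<Rightarrow> (int \<Rightarrow> 'a) set \<Rightarrow> (int \<Rightarrow> 'a) set" where
  "language n s Y = window_word n s ` Y"

text \<open>If \<open>\<tau>\<close> is determined by the window \<open>{-s..s}\<close>, then for a word of \<open>language n s Y\<close> and \<open>i < n\<close>
  the value below does not depend on the chosen \<open>y\<close>.\<close>

definition word_sum ::
  "((int \<Rightarrow> 'a) \<Rightarrow> int) \<Rightarrow> nat \<Rightarrow> nat \<Rightarrow> (int \<Rightarrow> 'a) set \<Rightarrow> nat \<Rightarrow> (int \<Rightarrow> 'a) \<Rightarrow> int" where
  "word_sum \<tau> n s Y i w = cocycle_sum \<tau> i (SOME y. y \<in> Y \<and> window_word n s y = w)"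

definition word_range ::
  "((int \<Rightarrow> 'a) \<Rightarrow> int) \<Rightarrow> nat \<Rightarrow> nat \<Rightarrow> (int \<Rightarrow> 'a) set \<Rightarrow> (int \<Rightarrow> 'a) \<Rightarrow> nat" where
  "word_range \<tau> n s Y w = card ((\<lambda>i. word_sum \<tau> n s Y i w) ` {..<n})"

definition cocycle_unbounded ::
  "real \<Rightarrow> (int \<Rightarrow> 'a) set \<Rightarrow> ((int \<Rightarrow> 'a) \<Rightarrow> int) \<Rightarrow> bool" where
  "cocycle_unbounded lam Y \<tau> \<longleftrightarrow>
    (\<exists>s. determined_by_window Y \<tau> s \<and>
      (\<forall>N. liminf (\<lambda>n. ereal (real (card {w \<in> language n s Y. word_range \<tau> n s Y w \<ge> N}) /
                              real (card (language n s Y)))) \<ge> ereal lam))"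

end

theory Submission imports Defs begin

text \<open>
  Write \<open>L\<close> for the words of \<open>Y\<close> of length \<open>n\<close>, and for a word \<open>w\<close> let the \<^emph>\<open>width\<close> of \<open>w\<close> be the number
  of integers in the convex hull of the values that the cocycle takes along \<open>w\<close>. Over the word \<open>w\<close>,
  an orbit of length \<open>n\<close> of the skew product moves the point of \<open>X\<close> through the times
  \<open>\<tau>\<^sup>i(w)\<close>. As \<open>\<tau>\<close> is bounded, these times are relatively dense in their hull with uniformly bounded
  gaps, and by invertibility the hull may be translated to \<open>{0..<width}\<close>. So, up to a change of
  radius and a constant factor, the complexity of the skew product at time \<open>n\<close> is the sum of
  \<open>spa T {..<width w}\<close> over the words \<open>w\<close> in \<open>L\<close>.

  A factor map is uniformly continuous, so it does not increase this complexity. Lemma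
  \<open>sum_spa_comparison\<close> makes this precise: for every radius \<open>\<epsilon>\<close> there are \<open>\<delta>\<close> and \<open>C\<close> with

  \<open>(\<Sum>w\<in>L. spa T2 {..<width w} \<epsilon>) \<le> C * (\<Sum>w\<in>L. spa T1 {..<width w} \<delta>)\<close> for all \<open>n > 0\<close>.

  The factor map may mix the two coordinates, so the comparison holds only for the sums over all words
  and not word by word.

  Suppose now that the upper entropy of \<open>T1\<close> is less than the lower entropy of \<open>T2\<close> for a scale.
  Then, for a suitable \<open>\<epsilon>\<close> and every \<open>\<delta>\<close>, the ratio \<open>spa T1 {..<m} \<delta> / spa T2 {..<m} \<epsilon>\<close> tends to 0, while
  the denominator tends to infinity. The comparison then forces the average of
  \<open>spa T2 {..<width w} \<epsilon>\<close> over the words to stay bounded as \<open>n\<close> grows. This contradicts unboundedness of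
  the cocycle, by which a positive proportion of the words has large width
  (lemma \<open>average_comparison_contradiction\<close>).

  Topological entropy is the slow entropy of the scale \<open>exp (n t)\<close>. By submultiplicativity of spanning
  numbers its upper and lower versions agree, so the inequality for scales contains the one for
  topological entropy.
\<close>

section \<open>Spanning numbers\<close>

lemma uniformly_close_family:
  fixes X :: "'x::metric_space set" and f :: "'i \<Rightarrow> 'x \<Rightarrow> 'y::metric_space"
  assumes "compact X" "finite F" "\<And>i. i \<in> F \<Longrightarrow> continuous_on X (f i)" "\<epsilon> > 0"
  obtains \<delta> where "\<delta> > 0"
    "\<And>i x y. i \<in> F \<Longrightarrow> x \<in> X \<Longrightarrow> y \<in> X \<Longrightarrow> dist x y \<le> \<delta> \<Longrightarrow> dist (f i x) (f i y) \<le> \<epsilon>"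
proof -
  have "\<exists>\<delta>>0. \<forall>i\<in>F. \<forall>x\<in>X. \<forall>y\<in>X. dist x y \<le> \<delta> \<longrightarrow> dist (f i x) (f i y) \<le> \<epsilon>"
    using assms(2,3)
  proof (induction F rule: finite_induct)
    case empty
    show ?case by (rule exI[of _ 1]) simp
  next
    case (insert i F)
    then obtain \<delta> where \<delta>: "\<delta> > 0"
      "\<forall>i\<in>F. \<forall>x\<in>X. \<forall>y\<in>X. dist x y \<le> \<delta> \<longrightarrow> dist (f i x) (f i y) \<le> \<epsilon>"
      by auto
    have "uniformly_continuous_on X (f i)"
      using insert.prems assms(1) by (intro compact_uniformly_continuous) auto
    then obtain d where d: "d > 0"
      "\<And>x y. x \<in> X \<Longrightarrow> y \<in> X \<Longrightarrow> dist y x < d \<Longrightarrow> dist (f i y) (f i x) < \<epsilon>"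
      unfolding uniformly_continuous_on_def using assms(4) by metis
    have "\<forall>j\<in>insert i F. \<forall>x\<in>X. \<forall>y\<in>X.
        dist x y \<le> min \<delta> (d / 2) \<longrightarrow> dist (f j x) (f j y) \<le> \<epsilon>"
    proof (intro ballI impI)
      fix j x y assume j: "j \<in> insert i F" and xy: "x \<in> X" "y \<in> X" "dist x y \<le> min \<delta> (d / 2)"
      show "dist (f j x) (f j y) \<le> \<epsilon>"
      proof (cases "j \<in> F")
        case True
        then show ?thesis using \<delta> xy by auto
      next
        case False
        then have "j = i" using j by simp
        moreover have "dist x y < d" using xy(3) d(1) by simp
        ultimately show ?thesis using d(2)[OF xy(2,1)] by auto
      qed
    qed
    moreover have "min \<delta> (d / 2) > 0" using \<delta>(1) d(1) by simp
    ultimately show ?case by blast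
  qed
  then show ?thesis using that by blast
qed

lemma tds_iterate:
  assumes "tds X T"
  shows tds_iterate_in: "x \<in> X \<Longrightarrow> (T ^^ i) x \<in> X"
    and continuous_on_tds_iterate: "continuous_on X (T ^^ i)"
proof -
  have T: "continuous_on X T" "T ` X \<subseteq> X" using assms by (auto simp: tds_def)
  have im: "(T ^^ i) ` X \<subseteq> X" for i
    using T(2) by (induction i) (auto simp: image_subset_iff)
  show "x \<in> X \<Longrightarrow> (T ^^ i) x \<in> X" using im by auto
  show "continuous_on X (T ^^ i)"
  proof (induction i)
    case 0
    show ?case by (simp add: id_def)
  next
    case (Suc i)
    then show ?case
      using continuous_on_compose[OF Suc, of T] continuous_on_subset[OF T(1) im[of i]] by simp
  qed
qed

lemma spa_attained:
  assumes "tds X T" "finite F" "\<epsilon> > 0"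
  obtains E where "finite E" "card E = spa X T F \<epsilon>" "spanning X T F \<epsilon> E"
proof -
  have X: "compact X" using assms(1) by (simp add: tds_def)
  obtain \<delta> where \<delta>: "\<delta> > 0"
    "\<And>i x y. i \<in> F \<Longrightarrow> x \<in> X \<Longrightarrow> y \<in> X \<Longrightarrow> dist x y \<le> \<delta> \<Longrightarrow> dist ((T ^^ i) x) ((T ^^ i) y) \<le> \<epsilon>"
    by (rule uniformly_close_family[where f = "\<lambda>i. T ^^ i", OF X assms(2) _ assms(3)])
       (use continuous_on_tds_iterate[OF assms(1)] in auto)
  obtain E where E: "finite E" "E \<subseteq> X" "X \<subseteq> (\<Union>x\<in>E. ball x \<delta>)"
    using seq_compact_imp_totally_bounded[of X] X \<delta>(1) by (auto simp: compact_eq_seq_compact_metric)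
  have "spanning X T F \<epsilon> E"
    unfolding spanning_def
  proof (intro conjI ballI)
    fix x assume x: "x \<in> X"
    then obtain e where e: "e \<in> E" "dist e x < \<delta>" using E(3) by auto
    then show "\<exists>y\<in>E. \<forall>i\<in>F. dist ((T ^^ i) x) ((T ^^ i) y) \<le> \<epsilon>"
      using \<delta>(2) x E(2) by (intro bexI[of _ e]) (auto simp: dist_commute)
  qed (use E in auto)
  then have "\<exists>k E. finite E \<and> card E = k \<and> spanning X T F \<epsilon> E" using E(1) by blast
  from LeastI_ex[OF this] show ?thesis using that unfolding spa_def by blast
qed

lemma spa_le_card: "finite E \<Longrightarrow> spanning X T F \<epsilon> E \<Longrightarrow> spa X T F \<epsilon> \<le> card E"
  unfolding spa_def by (rule Least_le) blast

text \<open>One representative of each class of a labelling with small classes spans. Labellings are more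
  convenient than spanning sets because they can be pulled back along arbitrary maps and combined
  into tuples.\<close>

lemma spa_le_card_labels:
  assumes fin: "finite (g ` X)"
    and close: "\<And>x y i. x \<in> X \<Longrightarrow> y \<in> X \<Longrightarrow> g x = g y \<Longrightarrow> i \<in> F \<Longrightarrow>
      dist ((T ^^ i) x) ((T ^^ i) y) \<le> \<epsilon>"
  shows "spa X T F \<epsilon> \<le> card (g ` X)"
proof -
  let ?E = "inv_into X g ` g ` X"
  have "spanning X T F \<epsilon> ?E"
    unfolding spanning_def
  proof (intro conjI ballI)
    show "?E \<subseteq> X" by (auto intro: inv_into_into)
    fix x assume x: "x \<in> X"
    show "\<exists>y\<in>?E. \<forall>i\<in>F. dist ((T ^^ i) x) ((T ^^ i) y) \<le> \<epsilon>"
    proof (intro bexI ballI)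
      fix i assume "i \<in> F"
      then show "dist ((T ^^ i) x) ((T ^^ i) (inv_into X g (g x))) \<le> \<epsilon>"
        using x by (intro close) (auto simp: f_inv_into_f inv_into_into)
    qed (use x in auto)
  qed
  then have "spa X T F \<epsilon> \<le> card ?E" using fin by (intro spa_le_card) auto
  also have "\<dots> \<le> card (g ` X)" using fin by (rule card_image_le)
  finally show ?thesis .
qed

text \<open>Conversely a minimal spanning set labels every point by a nearby centre, at the price of a
  factor 2 in the radius.\<close>

lemma spa_labelling:
  fixes X :: "'x::metric_space set"
  assumes "tds X T" "finite F" "\<epsilon> > 0"
  obtains E :: "'x set" and c where
    "finite E" "card E = spa X T F \<epsilon>" "c ` X \<subseteq> E"
    "\<forall>x\<in>X. \<forall>y\<in>X. c x = c y \<longrightarrow> (\<forall>i\<in>F. dist ((T ^^ i) x) ((T ^^ i) y) \<le> 2 * \<epsilon>)"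
proof -
  obtain E where E: "finite E" "card E = spa X T F \<epsilon>" "spanning X T F \<epsilon> E"
    by (rule spa_attained[OF assms])
  have "\<forall>x\<in>X. \<exists>y\<in>E. \<forall>i\<in>F. dist ((T ^^ i) x) ((T ^^ i) y) \<le> \<epsilon>"
    using E(3) by (simp add: spanning_def)
  then obtain c where c: "\<And>x. x \<in> X \<Longrightarrow> c x \<in> E"
    "\<And>x i. x \<in> X \<Longrightarrow> i \<in> F \<Longrightarrow> dist ((T ^^ i) x) ((T ^^ i) (c x)) \<le> \<epsilon>"
    by metis
  show ?thesis
  proof (rule that[OF E(1,2)])
    show "\<forall>x\<in>X. \<forall>y\<in>X. c x = c y \<longrightarrow> (\<forall>i\<in>F. dist ((T ^^ i) x) ((T ^^ i) y) \<le> 2 * \<epsilon>)"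
    proof (intro ballI impI)
      fix x y i assume *: "x \<in> X" "y \<in> X" "c x = c y" "i \<in> F"
      have "dist ((T ^^ i) x) ((T ^^ i) y)
          \<le> dist ((T ^^ i) x) ((T ^^ i) (c x)) + dist ((T ^^ i) y) ((T ^^ i) (c x))"
        by (rule dist_triangle2)
      also have "\<dots> \<le> \<epsilon> + \<epsilon>" using c(2)[OF *(1,4)] c(2)[OF *(2,4)] *(3) by (intro add_mono) auto
      finally show "dist ((T ^^ i) x) ((T ^^ i) y) \<le> 2 * \<epsilon>" by simp
    qed
  qed (use c in auto)
qed

lemma spa_mono:
  assumes "tds X T" "finite F'" "F \<subseteq> F'" "0 < \<epsilon>" "\<epsilon> \<le> \<epsilon>'"
  shows "spa X T F \<epsilon>' \<le> spa X T F' \<epsilon>"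
proof -
  obtain E where E: "finite E" "card E = spa X T F' \<epsilon>" "spanning X T F' \<epsilon> E"
    by (rule spa_attained[OF assms(1,2,4)])
  have "spanning X T F \<epsilon>' E"
    using E(3) assms(3,5) unfolding spanning_def by (meson order_trans subsetD)
  then show ?thesis using spa_le_card E by metis
qed

lemma spa_pos:
  assumes "tds X T" "finite F" "\<epsilon> > 0"
  shows "spa X T F \<epsilon> > 0"
proof -
  obtain E where E: "finite E" "card E = spa X T F \<epsilon>" "spanning X T F \<epsilon> E"
    by (rule spa_attained[OF assms])
  have "E \<noteq> {}" using E(3) assms(1) by (auto simp: spanning_def tds_def)
  then show ?thesis using E by (metis card_gt_0_iff)
qed

text \<open>Label a point by the centres of its orbit segments of length \<open>m\<close> that start at the multiples
  of \<open>m\<close>: there are at most \<open>k ^ j\<close> such lists of \<open>j\<close> centres out of \<open>k\<close>.\<close>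

lemma spa_submultiplicative:
  fixes X :: "'x::metric_space set"
  assumes "tds X T" "\<epsilon> > 0"
  shows "spa X T {..<j * m} \<epsilon> \<le> spa X T {..<m} (\<epsilon> / 2) ^ j"
proof -
  have half: "\<epsilon> / 2 > 0" using assms(2) by simp
  obtain E :: "'x set" and c where E: "finite E" "card E = spa X T {..<m} (\<epsilon> / 2)" "c ` X \<subseteq> E"
    and c: "\<forall>x\<in>X. \<forall>y\<in>X. c x = c y \<longrightarrow>
      (\<forall>i\<in>{..<m}. dist ((T ^^ i) x) ((T ^^ i) y) \<le> 2 * (\<epsilon> / 2))"
    by (rule spa_labelling[OF assms(1) finite_lessThan[of m] half])
  define g where "g x = map (\<lambda>i. c ((T ^^ (i * m)) x)) [0..<j]" for x
  have sub: "g ` X \<subseteq> {xs. set xs \<subseteq> E \<and> length xs = j}"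
    using E(3) tds_iterate_in[OF assms(1)] by (auto simp: g_def image_subset_iff)
  have fin: "finite {xs. set xs \<subseteq> E \<and> length xs = j}"
    using E(1) by (rule finite_lists_length_eq)
  have "spa X T {..<j * m} \<epsilon> \<le> card (g ` X)"
  proof (rule spa_le_card_labels)
    show "finite (g ` X)" using sub fin by (rule finite_subset)
    fix x y i assume *: "x \<in> X" "y \<in> X" "g x = g y" "i \<in> {..<j * m}"
    have q: "i div m < j" using *(4) by (simp add: less_mult_imp_div_less)
    have r: "i mod m \<in> {..<m}" using *(4) by (cases "m = 0") auto
    have "c ((T ^^ (i div m * m)) x) = c ((T ^^ (i div m * m)) y)"
      using *(3) q by (auto simp: g_def map_eq_conv)
    moreover have "(T ^^ (i div m * m)) x \<in> X" "(T ^^ (i div m * m)) y \<in> X"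
      using tds_iterate_in[OF assms(1)] *(1,2) by auto
    ultimately have "dist ((T ^^ (i mod m)) ((T ^^ (i div m * m)) x))
        ((T ^^ (i mod m)) ((T ^^ (i div m * m)) y)) \<le> 2 * (\<epsilon> / 2)"
      using c r by blast
    moreover have "(T ^^ i) z = (T ^^ (i mod m)) ((T ^^ (i div m * m)) z)" for z
      using funpow_add[of "i mod m" "i div m * m" T] by simp
    ultimately show "dist ((T ^^ i) x) ((T ^^ i) y) \<le> \<epsilon>" by simp
  qed
  also have "\<dots> \<le> card {xs. set xs \<subseteq> E \<and> length xs = j}" using sub fin by (intro card_mono)
  also have "\<dots> = spa X T {..<m} (\<epsilon> / 2) ^ j" using E by (simp add: card_lists_length_eq)
  finally show ?thesis .
qed

text \<open>A form of Fekete's lemma: if the spanning number at a single time \<open>m\<close> is below \<open>exp (c * m)\<close>, then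
  submultiplicativity propagates the bound to all large times and keeps the limit superior at most
  \<open>c\<close>. So a rate exceeded along a subsequence is reached at every time, at half the radius, which
  makes the limits superior and inferior interchangeable once the radius tends to 0.\<close>

lemma spa_ge_exp_of_limsup:
  assumes "tds X T" "\<epsilon> > 0"
    and c: "ereal c < limsup (\<lambda>n. ereal (ln (real (spa X T {..<n} \<epsilon>)) / real n))"
    and m: "m > 0"
  shows "exp (c * real m) \<le> real (spa X T {..<m} (\<epsilon> / 2))"
proof (rule ccontr)
  let ?S = "real (spa X T {..<m} (\<epsilon> / 2))"
  assume "\<not> exp (c * real m) \<le> ?S"
  then have less: "?S < exp (c * real m)" by simp
  have S1: "?S \<ge> 1" using spa_pos[OF assms(1), of "{..<m}" "\<epsilon> / 2"] assms(2) by simp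
  then have "ln ?S < ln (exp (c * real m))" using less by (subst ln_less_cancel_iff) auto
  then have "ln ?S < c * real m" by simp
  then have a: "ln ?S / real m < c" using m by (simp add: divide_less_eq)
  have le: "ln (real (spa X T {..<n} \<epsilon>)) / real n \<le> ln ?S / real m + ln ?S / real n"
    if n: "n > 0" for n
  proof -
    let ?j = "n div m + 1"
    have "n \<le> ?j * m" using m by (simp add: dividend_less_div_times less_imp_le add.commute)
    then have "spa X T {..<n} \<epsilon> \<le> spa X T {..<?j * m} \<epsilon>"
      by (intro spa_mono[OF assms(1)]) (use assms(2) in auto)
    also have "\<dots> \<le> spa X T {..<m} (\<epsilon> / 2) ^ ?j" by (rule spa_submultiplicative[OF assms(1,2)])
    finally have "real (spa X T {..<n} \<epsilon>) \<le> ?S ^ ?j"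
      by (metis of_nat_le_iff of_nat_power)
    moreover have "spa X T {..<n} \<epsilon> > 0" by (rule spa_pos[OF assms(1) _ assms(2)]) simp
    ultimately have "ln (real (spa X T {..<n} \<epsilon>)) \<le> ln (?S ^ ?j)" by (intro ln_mono) auto
    also have "\<dots> = real ?j * ln ?S" by (subst ln_realpow) (use S1 in auto)
    also have "\<dots> \<le> (real n / real m + 1) * ln ?S"
      using S1 by (intro mult_right_mono) (simp_all add: of_nat_div_le_of_nat)
    finally show ?thesis using n by (simp add: field_simps)
  qed
  have "(\<lambda>n. ln ?S / real m + ln ?S / real n) \<longlonglongrightarrow> ln ?S / real m + 0"
    by (intro tendsto_intros lim_const_over_n)
  then have "limsup (\<lambda>n. ereal (ln ?S / real m + ln ?S / real n)) = ereal (ln ?S / real m)"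
    by (intro lim_imp_Limsup) auto
  moreover have "limsup (\<lambda>n. ereal (ln (real (spa X T {..<n} \<epsilon>)) / real n))
      \<le> limsup (\<lambda>n. ereal (ln ?S / real m + ln ?S / real n))"
    using le by (intro Limsup_mono eventually_sequentiallyI[of 1]) auto
  ultimately have "ereal c < ereal (ln ?S / real m)" by (simp only: less_le_trans[OF c])
  then show False using a by simp
qed


section \<open>Entropies as suprema over the radius\<close>

lemma Lim_at_right_0_eq_SUP:
  fixes f :: "real \<Rightarrow> ereal"
  assumes anti: "\<And>a b. 0 < a \<Longrightarrow> a \<le> b \<Longrightarrow> f b \<le> f a"
  shows "Lim (at_right 0) f = (SUP \<epsilon>\<in>{0<..}. f \<epsilon>)"
proof (rule tendsto_Lim)
  show "(f \<longlongrightarrow> (SUP \<epsilon>\<in>{0<..}. f \<epsilon>)) (at_right 0)"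
  proof (rule order_tendstoI)
    fix l assume "l < (SUP \<epsilon>\<in>{0<..}. f \<epsilon>)"
    then obtain e where e: "e > 0" "l < f e" by (auto simp: less_SUP_iff)
    then show "\<forall>\<^sub>F x in at_right 0. l < f x"
      unfolding eventually_at_right_field
      using anti by (intro exI[of _ e]) (auto intro: less_le_trans)
  next
    fix u assume u: "(SUP \<epsilon>\<in>{0<..}. f \<epsilon>) < u"
    have "f x < u" if "x > 0" for x
      using u that by (meson SUP_upper greaterThan_iff le_less_trans)
    then show "\<forall>\<^sub>F x in at_right 0. f x < u"
      unfolding eventually_at_right_field by (intro exI[of _ 1]) auto
  qed
qed simp

lemma upper_ent_eq_SUP:
  assumes "tds X T" "scale b"
  shows "upper_ent b X T = (SUP \<epsilon>\<in>{0<..}. upper_ent_at b X T \<epsilon>)"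
  unfolding upper_ent_def
proof (rule Lim_at_right_0_eq_SUP)
  fix \<epsilon> \<epsilon>' :: real assume *: "0 < \<epsilon>" "\<epsilon> \<le> \<epsilon>'"
  have "limsup (\<lambda>n. ereal (real (spa X T {..<n} \<epsilon>') / b n t))
      \<le> limsup (\<lambda>n. ereal (real (spa X T {..<n} \<epsilon>) / b n t))" if "t > 0" for t
    using assms(2) that spa_mono[OF assms(1) _ order_refl *]
    by (intro Limsup_mono always_eventually allI) (auto simp: scale_def less_imp_le intro!: divide_right_mono)
  then show "upper_ent_at b X T \<epsilon>' \<le> upper_ent_at b X T \<epsilon>"
    unfolding upper_ent_at_def by (intro Sup_subset_mono Un_mono image_mono) (auto intro: less_le_trans)
qed

lemma lower_ent_eq_SUP:
  assumes "tds X T" "scale b"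
  shows "lower_ent b X T = (SUP \<epsilon>\<in>{0<..}. lower_ent_at b X T \<epsilon>)"
  unfolding lower_ent_def
proof (rule Lim_at_right_0_eq_SUP)
  fix \<epsilon> \<epsilon>' :: real assume *: "0 < \<epsilon>" "\<epsilon> \<le> \<epsilon>'"
  have "liminf (\<lambda>n. ereal (real (spa X T {..<n} \<epsilon>') / b n t))
      \<le> liminf (\<lambda>n. ereal (real (spa X T {..<n} \<epsilon>) / b n t))" if "t > 0" for t
    using assms(2) that spa_mono[OF assms(1) _ order_refl *]
    by (intro Liminf_mono always_eventually allI) (auto simp: scale_def less_imp_le intro!: divide_right_mono)
  then show "lower_ent_at b X T \<epsilon>' \<le> lower_ent_at b X T \<epsilon>"
    unfolding lower_ent_at_def by (intro Sup_subset_mono Un_mono image_mono) (auto intro: less_le_trans)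
qed

lemma h_top_eq_SUP:
  assumes "tds X T"
  shows "h_top X T = (SUP \<epsilon>\<in>{0<..}. limsup (\<lambda>n. ereal (ln (real (spa X T {..<n} \<epsilon>)) / real n)))"
  unfolding h_top_def
proof (rule Lim_at_right_0_eq_SUP)
  fix \<epsilon> \<epsilon>' :: real assume *: "0 < \<epsilon>" "\<epsilon> \<le> \<epsilon>'"
  then have \<epsilon>': "\<epsilon>' > 0" by simp
  have "ln (real (spa X T {..<n} \<epsilon>')) / real n \<le> ln (real (spa X T {..<n} \<epsilon>)) / real n" for n
  proof (intro divide_right_mono ln_mono)
    show "0 < real (spa X T {..<n} \<epsilon>')" using spa_pos[OF assms finite_lessThan \<epsilon>'] by simp
    show "real (spa X T {..<n} \<epsilon>') \<le> real (spa X T {..<n} \<epsilon>)"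
      using spa_mono[OF assms finite_lessThan order_refl *] by simp
  qed simp
  then show "limsup (\<lambda>n. ereal (ln (real (spa X T {..<n} \<epsilon>')) / real n))
      \<le> limsup (\<lambda>n. ereal (ln (real (spa X T {..<n} \<epsilon>)) / real n))"
    by (intro Limsup_mono always_eventually allI) (simp only: ereal_less_eq)
qed

definition exp_scale :: "nat \<Rightarrow> real \<Rightarrow> real" where
  "exp_scale n t = exp (real n * t)"

lemma scale_exp_scale: "scale exp_scale"
  unfolding scale_def
proof (intro conjI allI impI)
  fix t :: real assume t: "t > 0"
  show "incseq (\<lambda>n. exp_scale n t)"
    using t by (auto simp: incseq_def exp_scale_def intro!: mult_right_mono)
  have "filterlim (\<lambda>n. real n * t) at_top sequentially"
    using t by (intro filterlim_at_top_mult_tendsto_pos[of _ t] tendsto_const filterlim_real_sequentially)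
  then show "filterlim (\<lambda>n. exp_scale n t) at_top sequentially"
    unfolding exp_scale_def by (rule filterlim_compose[OF exp_at_top])
qed (auto simp: exp_scale_def mono_on_def intro!: mult_left_mono)

text \<open>Here the two notions of growth differ: \<open>h_top\<close> is a limit superior, the lower entropy a limit
  inferior. The passage to half the radius in the previous form of Fekete's lemma is harmless
  because both sides are suprema over all radii.\<close>

lemma h_top_le_lower_ent_exp_scale:
  assumes "tds X T"
  shows "h_top X T \<le> lower_ent exp_scale X T"
proof (rule ccontr)
  assume "\<not> h_top X T \<le> lower_ent exp_scale X T"
  then obtain c where c: "lower_ent exp_scale X T < ereal c" "ereal c < h_top X T"
    by (auto simp: not_le dest: ereal_dense2)
  have low: "lower_ent_at exp_scale X T \<epsilon> \<le> lower_ent exp_scale X T" if "\<epsilon> > 0" for \<epsilon>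
    unfolding lower_ent_eq_SUP[OF assms scale_exp_scale] using that by (intro SUP_upper) auto
  have "0 \<le> lower_ent_at exp_scale X T 1"
    unfolding lower_ent_at_def by (intro Sup_upper) auto
  then have "c > 0" 
    using low[of 1] c(1) by (auto dest: order_trans le_less_trans)
  obtain \<epsilon> where \<epsilon>: "\<epsilon> > 0" "ereal c < limsup (\<lambda>n. ereal (ln (real (spa X T {..<n} \<epsilon>)) / real n))"
    using c(2) unfolding h_top_eq_SUP[OF assms] by (auto simp: less_SUP_iff)
  have "1 \<le> real (spa X T {..<n} (\<epsilon> / 2)) / exp_scale n c" if "n \<ge> 1" for n
    using spa_ge_exp_of_limsup[OF assms \<epsilon>, of n] that by (simp add: exp_scale_def mult.commute)
  then have "1 \<le> liminf (\<lambda>n. ereal (real (spa X T {..<n} (\<epsilon> / 2)) / exp_scale n c))"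
    by (intro Liminf_bounded eventually_sequentiallyI[of 1]) (simp add: one_ereal_def)
  then have "0 < liminf (\<lambda>n. ereal (real (spa X T {..<n} (\<epsilon> / 2)) / exp_scale n c))"
    by (rule less_le_trans[rotated]) simp
  then have "ereal c \<le> lower_ent_at exp_scale X T (\<epsilon> / 2)"
    unfolding lower_ent_at_def using \<open>c > 0\<close> by (intro Sup_upper) auto
  also have "\<dots> \<le> lower_ent exp_scale X T" using \<epsilon>(1) by (intro low) simp
  finally show False using c(1) by simp
qed

lemma upper_ent_exp_scale_le_h_top:
  assumes "tds X T"
  shows "upper_ent exp_scale X T \<le> h_top X T"
  unfolding upper_ent_eq_SUP[OF assms scale_exp_scale]
proof (rule SUP_least)
  fix \<epsilon> :: real assume "\<epsilon> \<in> {0<..}"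
  then have \<epsilon>: "\<epsilon> > 0" by simp
  let ?f = "\<lambda>n. ereal (ln (real (spa X T {..<n} \<epsilon>)) / real n)"
  have le: "limsup ?f \<le> h_top X T"
    unfolding h_top_eq_SUP[OF assms] using \<epsilon> by (intro SUP_upper) auto
  have pos: "real (spa X T {..<n} \<epsilon>) \<ge> 1" for n
    using spa_pos[OF assms _ \<epsilon>, of "{..<n}"] by simp
  have "0 \<le> limsup ?f"
    by (intro le_Limsup always_eventually allI) (auto intro!: divide_nonneg_nonneg ln_ge_zero pos)
  moreover have "ereal t \<le> limsup ?f"
    if t: "t > 0" "limsup (\<lambda>n. ereal (real (spa X T {..<n} \<epsilon>) / exp_scale n t)) > 0" for t
  proof (rule ccontr)
    assume "\<not> ereal t \<le> limsup ?f"
    then obtain u where u: "limsup ?f < ereal u" "u < t"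
      by (auto simp: not_le dest: ereal_dense2)
    have "\<forall>\<^sub>F n in sequentially. ?f n < ereal u" using Limsup_lessD[OF u(1)] .
    then have "\<forall>\<^sub>F n in sequentially.
        real (spa X T {..<n} \<epsilon>) / exp_scale n t \<le> exp (- ((t - u) * real n))"
      using eventually_gt_at_top[of 0]
    proof eventually_elim
      case (elim n)
      then have "ln (real (spa X T {..<n} \<epsilon>)) < u * real n" by (simp add: divide_less_eq)
      then have "exp (ln (real (spa X T {..<n} \<epsilon>))) < exp (u * real n)" by simp
      then have "real (spa X T {..<n} \<epsilon>) < exp (u * real n)"
        using pos[of n] by (subst (asm) exp_ln) auto
      then show ?case
        by (simp add: exp_scale_def divide_le_eq flip: exp_add) (simp add: algebra_simps)
    qed
    then have "limsup (\<lambda>n. ereal (real (spa X T {..<n} \<epsilon>) / exp_scale n t))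
        \<le> limsup (\<lambda>n. ereal (exp (- ((t - u) * real n))))"
      by (intro Limsup_mono) simp
    also have "\<dots> = 0"
    proof (rule lim_imp_Limsup)
      have "filterlim (\<lambda>n. (t - u) * real n) at_top sequentially"
        using u(2) by (intro filterlim_tendsto_pos_mult_at_top[of _ "t - u"] tendsto_const filterlim_real_sequentially) auto
      then have "(\<lambda>n. exp (- ((t - u) * real n))) \<longlonglongrightarrow> 0"
        by (intro filterlim_compose[OF exp_at_bot]) (simp add: filterlim_uminus_at_bot)
      then show "(\<lambda>n. ereal (exp (- ((t - u) * real n)))) \<longlonglongrightarrow> 0"
        by (simp add: zero_ereal_def)
    qed simp
    finally show False using t(2) by simp
  qed
  ultimately have "upper_ent_at exp_scale X T \<epsilon> \<le> limsup ?f"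
    unfolding upper_ent_at_def by (intro Sup_least) auto
  then show "upper_ent_at exp_scale X T \<epsilon> \<le> h_top X T" using le by (rule order_trans)
qed


section \<open>Integer iterates and skew products\<close>

lemma invertible_tdsD:
  assumes "invertible_tds X T"
  shows invertible_tds_tds: "tds X T"
    and invertible_tds_bij: "bij_betw T X X"
    and invertible_tds_continuous_inv: "continuous_on X (inv_into X T)"
proof -
  show "tds X T" using assms by (simp add: invertible_tds_def)
  obtain T' where T': "homeomorphism X X T T'" using assms by (auto simp: invertible_tds_def)
  show bij: "bij_betw T X X" using T' by (auto simp: bij_betw_def homeomorphism_def intro: inj_on_inverseI)
  have "inv_into X T x = T' x" if "x \<in> X" for x
  proof (rule inv_into_f_eq)
    show "inj_on T X" using bij by (simp add: bij_betw_def)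
    show "T' x \<in> X" "T (T' x) = x" using T' that by (auto simp: homeomorphism_def)
  qed
  then show "continuous_on X (inv_into X T)"
    using T' by (metis continuous_on_cong homeomorphism_cont2)
qed

lemma int_iterate_of_nat: "int_iterate X T (int i) = T ^^ i"
  by (simp add: int_iterate_def)

lemma int_iterate_minus_of_nat: "int_iterate X T (- int i) = inv_into X T ^^ i"
  by (cases i) (simp_all add: int_iterate_def nat_add_distrib)

lemma int_iterate_0 [simp]: "int_iterate X T 0 x = x"
  by (simp add: int_iterate_def)

lemma int_iterate_in:
  assumes "invertible_tds X T" "x \<in> X"
  shows "int_iterate X T k x \<in> X"
proof -
  have bij: "bij_betw T X X" using assms(1) by (rule invertible_tds_bij)
  have "(T ^^ n) x \<in> X" for n
    using assms(2) bij by (induction n) (auto simp: bij_betw_apply)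
  moreover have "(inv_into X T ^^ n) x \<in> X" for n
    using assms(2) bij_betw_inv_into[OF bij] by (induction n) (auto simp: bij_betw_apply)
  ultimately show ?thesis by (simp add: int_iterate_def)
qed

lemma int_iterate_plus_1:
  assumes "invertible_tds X T" "x \<in> X"
  shows "int_iterate X T (k + 1) x = T (int_iterate X T k x)"
proof (cases "k \<ge> 0")
  case True
  then have "nat (k + 1) = Suc (nat k)" by simp
  with True show ?thesis by (simp add: int_iterate_def)
next
  case False
  define m where "m = nat (- (k + 1))"
  have k: "k + 1 = - int m" "k = - int (Suc m)" using False by (simp_all add: m_def)
  have bij: "bij_betw T X X" using assms(1) by (rule invertible_tds_bij)
  have "(inv_into X T ^^ m) x \<in> X"
    using assms(2) bij_betw_inv_into[OF bij] by (induction m) (auto simp: bij_betw_apply)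
  then have "T (inv_into X T ((inv_into X T ^^ m) x)) = (inv_into X T ^^ m) x"
    using bij by (simp add: bij_betw_inv_into_right)
  moreover have "int_iterate X T (k + 1) x = (inv_into X T ^^ m) x"
    unfolding k(1) int_iterate_minus_of_nat ..
  moreover have "int_iterate X T k x = inv_into X T ((inv_into X T ^^ m) x)"
    unfolding k(2) int_iterate_minus_of_nat by simp
  ultimately show ?thesis by simp
qed

lemma int_iterate_add:
  assumes "invertible_tds X T" "x \<in> X"
  shows "int_iterate X T (j + k) x = int_iterate X T j (int_iterate X T k x)"
proof (induction j rule: int_induct[where k = 0])
  case base
  show ?case by simp
next
  case (step1 j)
  then show ?case
    using int_iterate_plus_1[OF assms, of "j + k"]
      int_iterate_plus_1[OF assms(1) int_iterate_in[OF assms], of j k]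
    by (simp add: algebra_simps)
next
  case (step2 j)
  let ?a = "int_iterate X T (j - 1 + k) x" and ?b = "int_iterate X T (j - 1) (int_iterate X T k x)"
  have "T ?a = T ?b"
    using step2 int_iterate_plus_1[OF assms, of "j - 1 + k"]
      int_iterate_plus_1[OF assms(1) int_iterate_in[OF assms], of "j - 1" k]
    by (simp add: algebra_simps)
  then show ?case
    using bij_betw_imp_inj_on[OF invertible_tds_bij[OF assms(1)]] int_iterate_in[OF assms(1)] assms(2)
    by (meson inj_onD)
qed

lemma continuous_on_int_iterate:
  assumes "invertible_tds X T"
  shows "continuous_on X (int_iterate X T k)"
proof -
  have bij: "bij_betw T X X" using assms by (rule invertible_tds_bij)
  have tds: "tds X T" using assms by (rule invertible_tds_tds)
  then have "tds X (inv_into X T)"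
    using invertible_tds_continuous_inv[OF assms] bij_betw_inv_into[OF bij]
    by (auto simp: tds_def bij_betw_def)
  then show ?thesis
    using continuous_on_tds_iterate[OF tds] continuous_on_tds_iterate[of X "inv_into X T"]
    by (simp add: int_iterate_def)
qed

lemma shift_iterate: "(shift ^^ i) y j = y (j + int i)"
  by (induction i arbitrary: j) (simp_all add: shift_def algebra_simps)

lemma subshift_iterate_in: "subshift Y \<Longrightarrow> y \<in> Y \<Longrightarrow> (shift ^^ i) y \<in> Y"
  by (induction i) (auto simp: subshift_def)

lemma skew_product_iterate:
  assumes "invertible_tds X T" "x \<in> X"
  shows "(skew_product \<tau> X T ^^ i) (y, x) = ((shift ^^ i) y, int_iterate X T (cocycle_sum \<tau> i y) x)"
proof (induction i)
  case 0
  show ?case by (simp add: cocycle_sum_def)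
next
  case (Suc i)
  have "cocycle_sum \<tau> (Suc i) y = \<tau> ((shift ^^ i) y) + cocycle_sum \<tau> i y"
    by (simp add: cocycle_sum_def)
  then show ?case
    using Suc int_iterate_add[OF assms, of "\<tau> ((shift ^^ i) y)" "cocycle_sum \<tau> i y"]
    by (simp add: skew_product_def)
qed

lemma factor_map_iterate:
  assumes "factor_map Z R W Q \<pi>" "R ` Z \<subseteq> Z" "z \<in> Z"
  shows "\<pi> ((R ^^ i) z) = (Q ^^ i) (\<pi> z)"
proof -
  have "(R ^^ i) z \<in> Z \<and> \<pi> ((R ^^ i) z) = (Q ^^ i) (\<pi> z)"
    using assms by (induction i) (auto simp: factor_map_def)
  then show ?thesis ..
qed


section \<open>Cylinders and uniform continuity\<close>

lemma open_cylinder: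
  fixes y :: "int \<Rightarrow> 'a::discrete_topology"
  shows "open {y'. \<forall>j\<in>{-int k..int k}. y' j = y j}"
proof -
  have "open ((\<lambda>y'. y' j) -` {y j})" for j
    by (intro open_vimage open_discrete continuous_on_product_coordinates)
  then have "open (\<Inter>j\<in>{-int k..int k}. (\<lambda>y'. y' j) -` {y j})"
    by (intro open_INT) auto
  moreover have "(\<Inter>j\<in>{-int k..int k}. (\<lambda>y'. y' j) -` {y j}) = {y'. \<forall>j\<in>{-int k..int k}. y' j = y j}"
    by auto
  ultimately show ?thesis by simp
qed

text \<open>Cylinders around a point form a neighbourhood basis of the product topology: a basic open set
  constrains finitely many coordinates, and these lie in some window around 0.\<close>

lemma cylinder_subset_open:
  fixes y :: "int \<Rightarrow> 'a::topological_space"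
  assumes "open U" "y \<in> U"
  obtains k where "{y'. \<forall>j\<in>{-int k..int k}. y' j = y j} \<subseteq> U"
proof -
  have "openin (product_topology (\<lambda>i. euclidean) UNIV) U" using assms(1) by (simp add: open_fun_def)
  then obtain B where B: "y \<in> Pi\<^sub>E UNIV B" "finite {i. B i \<noteq> topspace euclidean}" "Pi\<^sub>E UNIV B \<subseteq> U"
    using product_topology_open_contains_basis[OF _ assms(2)] by meson
  define k where "k = nat (Max (insert 0 (abs ` {i. B i \<noteq> UNIV})))"
  have fin: "finite (insert 0 (abs ` {i. B i \<noteq> UNIV}))" using B(2) by simp
  have k: "\<bar>i\<bar> \<le> int k" if "B i \<noteq> UNIV" for i
    
    using Max_ge[OF fin, of "\<bar>i\<bar>"] that unfolding k_def by simp linarith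
  have "{y'. \<forall>j\<in>{-int k..int k}. y' j = y j} \<subseteq> U"
  proof
    fix y' assume "y' \<in> {y'. \<forall>j\<in>{-int k..int k}. y' j = y j}"
    then have y': "\<And>j. \<bar>j\<bar> \<le> int k \<Longrightarrow> y' j = y j" by (auto simp: abs_le_iff)
    have "y' i \<in> B i" for i
      using B(1) k[of i] y'[of i] by (cases "B i = UNIV") (auto simp: PiE_iff)
    then show "y' \<in> U" using B(3) by (auto simp: PiE_iff)
  qed
  then show ?thesis by (rule that)
qed

lemma compact_subshift:
  fixes Y :: "(int \<Rightarrow> 'a::{finite,discrete_topology}) set"
  assumes "subshift Y"
  shows "compact Y"
proof -
  have "compact_space (product_topology (\<lambda>i::int. euclidean :: 'a topology) UNIV)"
    unfolding compact_space_product_topology by (auto simp: compact_space_def finite_imp_compact)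
  then have "compact (UNIV :: (int \<Rightarrow> 'a) set)"
    by (simp add: compact_space_def euclidean_product_topology flip: compactin_euclidean_iff)
  then show ?thesis using assms compact_Int_closed[of UNIV Y] by (simp add: subshift_def)
qed

lemma cocycle_bounded:
  fixes Y :: "(int \<Rightarrow> 'a::{finite,discrete_topology}) set"
  assumes "subshift Y" "continuous_on Y \<tau>"
  obtains K :: nat where "\<And>y. y \<in> Y \<Longrightarrow> \<bar>\<tau> y\<bar> \<le> int K"
proof -
  have "compact (\<tau> ` Y)"
    by (rule compact_continuous_image[OF assms(2) compact_subshift[OF assms(1)]])
  moreover have "open {k}" for k :: int by (rule open_discrete)
  moreover have "\<tau> ` Y \<subseteq> (\<Union>k\<in>\<tau> ` Y. {k})" by auto
  ultimately obtain C where C: "finite C" "\<tau> ` Y \<subseteq> (\<Union>k\<in>C. {k})"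
    by (rule compactE_image)
  have "\<bar>\<tau> y\<bar> \<le> int (Max (nat ` abs ` C))" if "y \<in> Y" for y
  proof -
    have "nat \<bar>\<tau> y\<bar> \<le> Max (nat ` abs ` C)" using C that by (intro Max_ge) auto
    then show ?thesis by linarith
  qed
  then show ?thesis by (rule that)
qed

text \<open>The Heine--Cantor theorem for a map between products of a symbolic space and a metric space. On
  the symbolic coordinate, closeness is expressed as equality on a finite window around 0. The
  proof is the Lebesgue number argument for a finite cover by boxes (cylinder times ball).\<close>

lemma uniformly_continuous_symbolic:
  fixes Y :: "(int \<Rightarrow> 'a::{finite,discrete_topology}) set" and X :: "'x::metric_space set"
    and \<pi> :: "(int \<Rightarrow> 'a) \<times> 'x \<Rightarrow> (int \<Rightarrow> 'b::discrete_topology) \<times> 'z::metric_space"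
  assumes Y: "compact Y" and X: "compact X" and \<pi>: "continuous_on (Y \<times> X) \<pi>" and \<epsilon>: "\<epsilon> > 0"
  obtains \<delta> k where "\<delta> > 0"
    "\<forall>y\<in>Y. \<forall>y'\<in>Y. \<forall>x\<in>X. \<forall>x'\<in>X. dist x x' \<le> \<delta> \<longrightarrow> (\<forall>j\<in>{-int k..int k}. y j = y' j) \<longrightarrow>
      dist (snd (\<pi> (y, x))) (snd (\<pi> (y', x'))) \<le> \<epsilon> \<and>
      (\<forall>j\<in>{-int s..int s}. fst (\<pi> (y, x)) j = fst (\<pi> (y', x')) j)"
proof -
  define good where "good z k \<delta> \<longleftrightarrow> \<delta> > 0 \<and> (\<forall>w\<in>Y \<times> X. dist (snd z) (snd w) < 2 * \<delta> \<longrightarrow>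
      (\<forall>j\<in>{-int k..int k}. fst w j = fst z j) \<longrightarrow>
      dist (snd (\<pi> z)) (snd (\<pi> w)) < \<epsilon> / 2 \<and> (\<forall>j\<in>{-int s..int s}. fst (\<pi> w) j = fst (\<pi> z) j))"
    for z k \<delta>
  have "\<exists>k \<delta>. good z k \<delta>" if z: "z \<in> Y \<times> X" for z
  proof -
    let ?V = "{v. \<forall>j\<in>{-int s..int s}. v j = fst (\<pi> z) j} \<times> ball (snd (\<pi> z)) (\<epsilon> / 2)"
    have "open ?V" by (intro open_Times open_cylinder open_ball)
    from \<pi>[unfolded continuous_on_open_invariant, rule_format, OF this]
    obtain A where A: "open A" "A \<inter> (Y \<times> X) = \<pi> -` ?V \<inter> (Y \<times> X)" by blast
    have "\<pi> z \<in> ?V" using \<epsilon> by (auto simp: mem_Times_iff)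
    then have "z \<in> A" using A(2) z by auto
    with A(1) obtain A1 A2 where "open A1" "open A2" "z \<in> A1 \<times> A2" and sub: "A1 \<times> A2 \<subseteq> A"
      by (rule open_prod_elim)
    then have A12: "open A1" "open A2" "fst z \<in> A1" "snd z \<in> A2" by auto
    obtain k where k: "{y'. \<forall>j\<in>{-int k..int k}. y' j = fst z j} \<subseteq> A1"
      by (rule cylinder_subset_open[OF A12(1,3)])
    obtain e where e: "e > 0" "ball (snd z) e \<subseteq> A2" using A12(2,4) by (auto simp: open_contains_ball)
    have "good z k (e / 2)"
      unfolding good_def
    proof (intro conjI ballI impI)
      fix w assume *: "w \<in> Y \<times> X" "dist (snd z) (snd w) < 2 * (e / 2)" "\<forall>j\<in>{-int k..int k}. fst w j = fst z j"
      have "fst w \<in> A1" using k *(3) by auto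
      moreover have "snd w \<in> A2" using e *(2) by (auto simp: subset_iff)
      ultimately have "w \<in> A1 \<times> A2" by (simp add: mem_Times_iff)
      then have "w \<in> A" using sub by (rule subsetD[rotated])
      then have V: "\<pi> w \<in> ?V" using A(2) *(1) by blast
      then show "dist (snd (\<pi> z)) (snd (\<pi> w)) < \<epsilon> / 2" by (simp add: mem_Times_iff)
      fix j assume "j \<in> {-int s..int s}"
      then show "fst (\<pi> w) j = fst (\<pi> z) j" using V by (simp add: mem_Times_iff)
    qed (use e in auto)
    then show ?thesis by blast
  qed
  then obtain k \<delta> where good: "\<And>z. z \<in> Y \<times> X \<Longrightarrow> good z (k z) (\<delta> z)" by metis
  have \<delta>: "\<delta> z > 0" if "z \<in> Y \<times> X" for z using good[OF that] by (simp add: good_def)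
  define U where "U z = {y'. \<forall>j\<in>{-int (k z)..int (k z)}. y' j = fst z j} \<times> ball (snd z) (\<delta> z)" for z
  have "open (U z)" for z unfolding U_def by (intro open_Times open_cylinder open_ball)
  moreover have "Y \<times> X \<subseteq> (\<Union>z\<in>Y \<times> X. U z)"
  proof
    fix z assume "z \<in> Y \<times> X"
    then show "z \<in> (\<Union>z\<in>Y \<times> X. U z)" using \<delta> by (intro UN_I[of z]) (auto simp: U_def)
  qed
  ultimately obtain C where C: "C \<subseteq> Y \<times> X" "finite C" "Y \<times> X \<subseteq> (\<Union>z\<in>C. U z)"
    by (rule compactE_image[OF compact_Times[OF Y X], of "Y \<times> X" U])
  define d where "d = Min (insert 1 (\<delta> ` C))"
  define K where "K = Max (insert 0 (k ` C))"
  have d: "d > 0" using C(1,2) \<delta> by (auto simp: d_def)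
  show ?thesis
  proof (rule that[OF d, of K], intro ballI impI)
    fix y x y' x'
    assume *: "y \<in> Y" "y' \<in> Y" "x \<in> X" "x' \<in> X" "dist x x' \<le> d" "\<forall>j\<in>{-int K..int K}. y j = y' j"
    obtain z where zC: "z \<in> C" and zU: "(y, x) \<in> U z" using C(3) *(1,3) by blast
    have z: "z \<in> Y \<times> X" using zC C(1) by auto
    have yz: "\<forall>j\<in>{-int (k z)..int (k z)}. y j = fst z j" and xz: "dist (snd z) x < \<delta> z"
      using zU by (auto simp: U_def)
    have le: "k z \<le> K" "d \<le> \<delta> z" using zC C(2) by (auto simp: K_def d_def)
    have y'z: "\<forall>j\<in>{-int (k z)..int (k z)}. y' j = fst z j"
      using yz *(6) le(1) by auto
    have xz': "dist (snd z) x' < 2 * \<delta> z"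
      using dist_triangle[of "snd z" x' x] xz *(5) le(2) by linarith
    have xz2: "dist (snd z) x < 2 * \<delta> z" using xz \<delta>[OF z] by linarith
    have b: "dist (snd (\<pi> z)) (snd (\<pi> (y, x))) < \<epsilon> / 2 \<and>
        (\<forall>j\<in>{-int s..int s}. fst (\<pi> (y, x)) j = fst (\<pi> z) j)"
      using good[OF z] *(1,3) xz2 yz unfolding good_def by simp
    have b': "dist (snd (\<pi> z)) (snd (\<pi> (y', x'))) < \<epsilon> / 2 \<and>
        (\<forall>j\<in>{-int s..int s}. fst (\<pi> (y', x')) j = fst (\<pi> z) j)"
      using good[OF z] *(2,4) xz' y'z unfolding good_def by simp
    have "dist (snd (\<pi> (y, x))) (snd (\<pi> (y', x'))) < \<epsilon>"
      using dist_triangle3[of "snd (\<pi> (y, x))" "snd (\<pi> (y', x'))" "snd (\<pi> z)"] b b' by linarith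
    then show "dist (snd (\<pi> (y, x))) (snd (\<pi> (y', x'))) \<le> \<epsilon> \<and>
      (\<forall>j\<in>{-int s..int s}. fst (\<pi> (y, x)) j = fst (\<pi> (y', x')) j)"
      using b b' by simp
  qed
qed


section \<open>Words and the range of the cocycle\<close>

lemma window_word_eq_iff:
  "window_word n s y = window_word n s y' \<longleftrightarrow> (\<forall>j\<in>{- int s..int s + int n - 1}. y j = y' j)"
  by (auto simp: window_word_def restrict_def fun_eq_iff)

lemma finite_language:
  fixes Y :: "(int \<Rightarrow> 'a::finite) set"
  shows "finite (language n s Y)"
proof (rule finite_subset)
  show "language n s Y \<subseteq> Pi\<^sub>E {- int s..int s + int n - 1} (\<lambda>_. UNIV)"
    by (auto simp: language_def window_word_def)
qed (simp add: finite_PiE)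

definition word_rep :: "nat \<Rightarrow> nat \<Rightarrow> (int \<Rightarrow> 'a) set \<Rightarrow> (int \<Rightarrow> 'a) \<Rightarrow> int \<Rightarrow> 'a" where
  "word_rep n s Y w = (SOME y. y \<in> Y \<and> window_word n s y = w)"

lemma word_rep:
  assumes "w \<in> language n s Y"
  shows word_rep_in: "word_rep n s Y w \<in> Y" and window_word_rep: "window_word n s (word_rep n s Y w) = w"
proof -
  have "\<exists>y. y \<in> Y \<and> window_word n s y = w" using assms by (auto simp: language_def)
  from someI_ex[OF this] show "word_rep n s Y w \<in> Y" "window_word n s (word_rep n s Y w) = w"
    by (auto simp: word_rep_def)
qed

text \<open>The integers from \<open>drift_min\<close> to \<open>drift_min + drift_width - 1\<close> form the convex hull of the values
  \<open>cocycle_sum \<tau> i y\<close> with \<open>i < n\<close>. For \<open>n = 0\<close> there are no values, and these numbers are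
  meaningless.\<close>

definition drift_min :: "((int \<Rightarrow> 'a) \<Rightarrow> int) \<Rightarrow> nat \<Rightarrow> (int \<Rightarrow> 'a) \<Rightarrow> int" where
  "drift_min \<tau> n y = Min ((\<lambda>i. cocycle_sum \<tau> i y) ` {..<n})"

definition drift_width :: "((int \<Rightarrow> 'a) \<Rightarrow> int) \<Rightarrow> nat \<Rightarrow> (int \<Rightarrow> 'a) \<Rightarrow> nat" where
  "drift_width \<tau> n y = nat (Max ((\<lambda>i. cocycle_sum \<tau> i y) ` {..<n}) - drift_min \<tau> n y + 1)"

definition word_width :: "((int \<Rightarrow> 'a) \<Rightarrow> int) \<Rightarrow> nat \<Rightarrow> nat \<Rightarrow> (int \<Rightarrow> 'a) set \<Rightarrow> (int \<Rightarrow> 'a) \<Rightarrow> nat" where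
  "word_width \<tau> n s Y w = drift_width \<tau> n (word_rep n s Y w)"

lemma cocycle_sum_cong_window:
  assumes "subshift Y" "determined_by_window Y \<tau> s" "y \<in> Y" "y' \<in> Y"
    and "window_word n s y = window_word n s y'" "i < n"
  shows "cocycle_sum \<tau> i y = cocycle_sum \<tau> i y'"
  unfolding cocycle_sum_def
proof (rule sum.cong)
  fix k assume k: "k \<in> {..<i}"
  have "\<forall>j\<in>{- int s..int s}. (shift ^^ k) y j = (shift ^^ k) y' j"
    using assms(5,6) k unfolding window_word_eq_iff shift_iterate by auto
  then show "\<tau> ((shift ^^ k) y) = \<tau> ((shift ^^ k) y')"
    using assms(1-4) subshift_iterate_in unfolding determined_by_window_def by blast
qed simp

lemma drift_cong_window:
  assumes "subshift Y" "determined_by_window Y \<tau> s" "y \<in> Y" "y' \<in> Y"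
    and "window_word n s y = window_word n s y'"
  shows drift_min_cong_window: "drift_min \<tau> n y = drift_min \<tau> n y'"
    and drift_width_cong_window: "drift_width \<tau> n y = drift_width \<tau> n y'"
proof -
  have "(\<lambda>i. cocycle_sum \<tau> i y) ` {..<n} = (\<lambda>i. cocycle_sum \<tau> i y') ` {..<n}"
    by (intro image_cong refl cocycle_sum_cong_window[OF assms]) simp
  then show "drift_min \<tau> n y = drift_min \<tau> n y'" "drift_width \<tau> n y = drift_width \<tau> n y'"
    by (simp_all add: drift_min_def drift_width_def)
qed

lemma word_width_window_word:
  assumes "subshift Y" "determined_by_window Y \<tau> s" "y \<in> Y"
  shows "word_width \<tau> n s Y (window_word n s y) = drift_width \<tau> n y"
proof -
  have "window_word n s y \<in> language n s Y" using assms(3) by (simp add: language_def)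
  from word_rep[OF this] show ?thesis
    unfolding word_width_def using drift_width_cong_window[OF assms(1,2) _ assms(3)] by blast
qed

lemma cocycle_sum_in_drift_hull:
  assumes "i < n"
  obtains m where "m < drift_width \<tau> n y" "cocycle_sum \<tau> i y = drift_min \<tau> n y + int m"
proof -
  let ?I = "(\<lambda>i. cocycle_sum \<tau> i y) ` {..<n}"
  have "cocycle_sum \<tau> i y \<le> Max ?I" "Min ?I \<le> cocycle_sum \<tau> i y"
    using assms by (auto intro!: Max_ge Min_le)
  then show ?thesis
    by (intro that[of "nat (cocycle_sum \<tau> i y - Min ?I)"]) (auto simp: drift_width_def drift_min_def)
qed

text \<open>Counting the hull instead of the values only enlarges the count, so words of large range have large
  width. In contrast to the set of values, the hull is determined up to translation by its size.\<close>

lemma word_range_le_word_width: "word_range \<tau> n s Y w \<le> word_width \<tau> n s Y w"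
proof -
  let ?y = "word_rep n s Y w"
  have "(\<lambda>i. cocycle_sum \<tau> i ?y) ` {..<n} \<subseteq> (\<lambda>m. drift_min \<tau> n ?y + int m) ` {..<drift_width \<tau> n ?y}"
    by (auto elim: cocycle_sum_in_drift_hull[of _ n \<tau> ?y])
  then have "card ((\<lambda>i. cocycle_sum \<tau> i ?y) ` {..<n}) \<le> drift_width \<tau> n ?y"
    by (rule order_trans[OF card_mono surj_card_le[OF finite_lessThan order_refl, simplified card_lessThan], rotated]) simp
  then show ?thesis by (simp add: word_range_def word_sum_def word_width_def word_rep_def)
qed

text \<open>A discrete intermediate value theorem: a walk with steps of size at most \<open>K\<close> that crosses a
  level comes within distance \<open>K\<close> of it.\<close>

lemma bounded_step_walk_hits:
  fixes f :: "nat \<Rightarrow> int"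
  assumes step: "\<And>i. i < b \<Longrightarrow> \<bar>f (Suc i) - f i\<bar> \<le> K" and "f 0 \<le> j" "j \<le> f b" "K \<ge> 0"
  shows "\<exists>k\<le>b. \<bar>j - f k\<bar> \<le> K"
  using assms
proof (induction b)
  case 0
  then show ?case by auto
next
  case (Suc b)
  show ?case
  proof (cases "j \<le> f b")
    case True
    then show ?thesis using Suc by (meson le_SucI less_SucI)
  next
    case False
    then have "\<bar>j - f (Suc b)\<bar> \<le> K" using Suc.prems(1)[of b] Suc.prems(3) by linarith
    then show ?thesis by blast
  qed
qed

text \<open>The values of the cocycle along an orbit segment need not form an interval, but there are no large
  gaps between them. The walk starts at 0, which lies in the hull, so every level of the hull is
  crossed on the way from 0 to one of its two ends.\<close>

lemma drift_hull_dense: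
  assumes "n > 0" and \<tau>: "\<And>i. \<bar>\<tau> ((shift ^^ i) y)\<bar> \<le> int K" and m: "m < drift_width \<tau> n y"
  shows "\<exists>k<n. \<bar>drift_min \<tau> n y + int m - cocycle_sum \<tau> k y\<bar> \<le> int K"
proof -
  let ?f = "\<lambda>i. cocycle_sum \<tau> i y" and ?j = "drift_min \<tau> n y + int m"
  have ne: "?f ` {..<n} \<noteq> {}" using assms(1) by (auto simp: lessThan_empty_iff)
  obtain a where a: "a < n" "drift_min \<tau> n y = ?f a"
    using Min_in[OF _ ne] by (auto simp: drift_min_def)
  obtain b where b: "b < n" "Max (?f ` {..<n}) = ?f b"
    using Max_in[OF _ ne] by auto
  have j: "?f a \<le> ?j" "?j \<le> ?f b" using m a b by (auto simp: drift_width_def)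
  have step: "\<bar>?f (Suc i) - ?f i\<bar> \<le> int K" for i
    using \<tau>[of i] by (simp add: cocycle_sum_def)
  show ?thesis
  proof (cases "?f 0 \<le> ?j")
    case True
    then obtain k where "k \<le> b" "\<bar>?j - ?f k\<bar> \<le> int K"
      using bounded_step_walk_hits[of b ?f "int K" ?j] step j by auto
    then show ?thesis using b(1) by (intro exI[of _ k]) auto
  next
    case False
    have "\<bar>- ?f (Suc i) - - ?f i\<bar> \<le> int K" for i using step[of i] by linarith
    then obtain k where "k \<le> a" "\<bar>- ?j - - ?f k\<bar> \<le> int K"
      using bounded_step_walk_hits[of a "\<lambda>i. - ?f i" "int K" "- ?j"] False j by auto
    then show ?thesis using a(1) by (intro exI[of _ k]) (auto simp: abs_if split: if_splits)
  qed
qed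


section \<open>Comparison of spanning numbers along the words\<close>

text \<open>The proof bounds the number of labels of a labelling \<open>g\<close> of \<open>Y \<times> X1\<close> from both sides. A label records
  the word of the sequence on a window that is larger by \<open>k\<close> on each side, and a centre of the point of
  \<open>X1\<close> for the times in the hull of the cocycle values. With \<open>C\<close> the number of ways to fill the \<open>2 * k\<close>
  extra places with letters, there are at most \<open>C\<close> times the sum on the right of such labels. On the
  other hand, points with the same label have images whose sequences have the same word and whose
  points in \<open>X2\<close> stay close at all times of the cocycle. So images over different words need
  different labels, and for each single word the labels induce a labelling of \<open>X2\<close> that is fine
  enough to bound \<open>spa X2 T2\<close> from above.\<close>

lemma sum_spa_comparison:
  fixes Y :: "(int \<Rightarrow> 'a::{finite,discrete_topology}) set"
    and X1 :: "'x1::metric_space set" and X2 :: "'x2::metric_space set"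
  assumes Y: "subshift Y" and \<tau>: "continuous_on Y \<tau>" and s: "determined_by_window Y \<tau> s"
    and X1: "invertible_tds X1 T1" and X2: "invertible_tds X2 T2"
    and \<pi>: "factor_map (Y \<times> X1) (skew_product \<tau> X1 T1) (Y \<times> X2) (skew_product \<tau> X2 T2) \<pi>"
    and \<epsilon>: "\<epsilon> > 0"
  obtains \<delta> C where "\<delta> > 0"
    "\<forall>n>0. (\<Sum>w\<in>language n s Y. spa X2 T2 {..<word_width \<tau> n s Y w} \<epsilon>)
      \<le> C * (\<Sum>w\<in>language n s Y. spa X1 T1 {..<word_width \<tau> n s Y w} \<delta>)"
proof -
  note tds1 = invertible_tds_tds[OF X1] and tds2 = invertible_tds_tds[OF X2]
  have compact: "compact X1" "compact X2" using tds1 tds2 by (simp_all add: tds_def)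
  obtain K where K: "\<And>y. y \<in> Y \<Longrightarrow> \<bar>\<tau> y\<bar> \<le> int K" using cocycle_bounded[OF Y \<tau>] by blast
  \<comment> \<open>closeness \<open>\<eta>\<close> at one time implies closeness \<open>\<epsilon>\<close> at all times within \<open>K\<close> of it; this fills the gaps
      between the cocycle values in their hull\<close>
  obtain \<eta> where \<eta>: "\<eta> > 0" "\<And>j x x'. j \<in> {- int K..int K} \<Longrightarrow> x \<in> X2 \<Longrightarrow> x' \<in> X2 \<Longrightarrow> dist x x' \<le> \<eta> \<Longrightarrow>
      dist (int_iterate X2 T2 j x) (int_iterate X2 T2 j x') \<le> \<epsilon>"
    by (rule uniformly_close_family[of X2 "{- int K..int K}" "int_iterate X2 T2" \<epsilon>])
       (use compact \<epsilon> continuous_on_int_iterate[OF X2] in auto)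
  have \<pi>c: "continuous_on (Y \<times> X1) \<pi>" and \<pi>im: "\<pi> ` (Y \<times> X1) = Y \<times> X2"
    using \<pi> by (auto simp: factor_map_def)
  obtain \<delta> k where \<delta>: "\<delta> > 0" and unif: "\<forall>y\<in>Y. \<forall>y'\<in>Y. \<forall>x\<in>X1. \<forall>x'\<in>X1.
      dist x x' \<le> \<delta> \<longrightarrow> (\<forall>j\<in>{-int k..int k}. y j = y' j) \<longrightarrow>
      dist (snd (\<pi> (y, x))) (snd (\<pi> (y', x'))) \<le> \<eta> \<and>
      (\<forall>j\<in>{-int s..int s}. fst (\<pi> (y, x)) j = fst (\<pi> (y', x')) j)"
    by (rule uniformly_continuous_symbolic[OF compact_subshift[OF Y] compact(1) \<pi>c \<eta>(1), where s = s])
  have \<delta>2: "\<delta> / 2 > 0" using \<delta> by simp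
  define labels where "labels m E c \<longleftrightarrow> finite E \<and> card E = spa X1 T1 {..<m} (\<delta> / 2) \<and> c ` X1 \<subseteq> E \<and>
      (\<forall>x\<in>X1. \<forall>x'\<in>X1. c x = c x' \<longrightarrow> (\<forall>i\<in>{..<m}. dist ((T1 ^^ i) x) ((T1 ^^ i) x') \<le> 2 * (\<delta> / 2)))"
    for m and E :: "'x1 set" and c
  have "\<exists>E c. labels m E c" for m
    unfolding labels_def by (rule spa_labelling[OF tds1 finite_lessThan[of m] \<delta>2]) blast
  then obtain E c where "\<And>m. labels m (E m) (c m)" by metis
  then have E: "finite (E m)" "card (E m) = spa X1 T1 {..<m} (\<delta> / 2)" "c m ` X1 \<subseteq> E m"
    and c: "\<forall>x\<in>X1. \<forall>x'\<in>X1. c m x = c m x' \<longrightarrow>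
      (\<forall>i\<in>{..<m}. dist ((T1 ^^ i) x) ((T1 ^^ i) x') \<le> 2 * (\<delta> / 2))" for m
    unfolding labels_def by blast+
  have skew_in: "skew_product \<tau> X1 T1 ` (Y \<times> X1) \<subseteq> Y \<times> X1"
    using Y int_iterate_in[OF X1] by (auto simp: skew_product_def subshift_def)

  have main: "(\<Sum>w\<in>language n s Y. spa X2 T2 {..<word_width \<tau> n s Y w} \<epsilon>)
      \<le> CARD('a) ^ (2 * k) * (\<Sum>w\<in>language n s Y. spa X1 T1 {..<word_width \<tau> n s Y w} (\<delta> / 2))"
    if n: "n > 0" for n
  proof -
    define L where "L = language n s Y"
    \<comment> \<open>the \<open>2 * k\<close> places around the window \<open>{- s..s + n - 1}\<close> at which the shifted sequences must agree for
        uniform continuity to apply at all times below \<open>n\<close>\<close>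
    define J where "J = {- int (s + k)..- int s - 1} \<union> {int s + int n..int s + int n + int k - 1}"
    define g where "g z = (window_word n s (fst z), restrict (fst z) J,
        c (drift_width \<tau> n (fst z)) (int_iterate X1 T1 (drift_min \<tau> n (fst z)) (snd z)))" for z
    define B where "B = Sigma L (\<lambda>w. Pi\<^sub>E J (\<lambda>_. UNIV :: 'a set) \<times> E (word_width \<tau> n s Y w))"
    have finL: "finite L" unfolding L_def by (rule finite_language)
    have finJ: "finite J" by (simp add: J_def)
    have "card J = 2 * k"
      unfolding J_def by (subst card_Un_disjoint) auto
    then have cardJ: "card (Pi\<^sub>E J (\<lambda>_. UNIV :: 'a set)) = CARD('a) ^ (2 * k)"
      using finJ by (simp add: card_PiE)
    have finB: "finite B" unfolding B_def using finL finJ E(1)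
      by (intro finite_SigmaI finite_cartesian_product finite_PiE) auto
    have cardB: "card B = CARD('a) ^ (2 * k) * (\<Sum>w\<in>L. spa X1 T1 {..<word_width \<tau> n s Y w} (\<delta> / 2))"
      unfolding B_def using finL finJ E(1,2) cardJ
      by (subst card_SigmaI) (auto simp: card_cartesian_product sum_distrib_left intro!: finite_PiE)
    have gB: "g z \<in> B" if z: "z \<in> Y \<times> X1" for z
    proof -
      have "fst z \<in> Y" "snd z \<in> X1" using z by auto
      then show ?thesis
        using E(3) int_iterate_in[OF X1] word_width_window_word[OF Y s]
        by (auto simp: g_def B_def L_def language_def image_subset_iff)
    qed
    \<comment> \<open>equal labels imply that the images under the factor map have the same word and stay close\<close>
    have same: "window_word n s (fst (\<pi> z)) = window_word n s (fst (\<pi> z')) \<and>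
        (\<forall>i<n. dist (int_iterate X2 T2 (cocycle_sum \<tau> i (fst (\<pi> z))) (snd (\<pi> z)))
          (int_iterate X2 T2 (cocycle_sum \<tau> i (fst (\<pi> z'))) (snd (\<pi> z'))) \<le> \<eta>)"
      if z: "z \<in> Y \<times> X1" and z': "z' \<in> Y \<times> X1" and gz: "g z = g z'" for z z'
    proof -
      obtain y x y' x' where yx: "z = (y, x)" "z' = (y', x')" by (cases z, cases z') auto
      have in1: "y \<in> Y" "y' \<in> Y" "x \<in> X1" "x' \<in> X1" using z z' yx by auto
      obtain u v u' v' where uv: "\<pi> z = (u, v)" "\<pi> z' = (u', v')" by (cases "\<pi> z", cases "\<pi> z'") auto
      have in2: "v \<in> X2" "v' \<in> X2"
        using imageI[OF z, of \<pi>] imageI[OF z', of \<pi>] uv unfolding \<pi>im by auto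
      have win: "window_word n s y = window_word n s y'" and "restrict y J = restrict y' J"
        using gz yx by (auto simp: g_def)
      then have all: "y j = y' j" if "j \<in> {- int s..int s + int n - 1} \<union> J" for j
        using that unfolding window_word_eq_iff by (auto dest: fun_cong[of _ _ j])
      have agree: "y j = y' j" if "j \<in> {- int k..int k + int n - 1}" for j
      proof (rule all)
        show "j \<in> {- int s..int s + int n - 1} \<union> J"
          using that unfolding J_def Un_iff atLeastAtMost_iff of_nat_add by linarith
      qed
      note lo = drift_min_cong_window[OF Y s in1(1,2) win] and wd = drift_width_cong_window[OF Y s in1(1,2) win]
      define a where "a = int_iterate X1 T1 (drift_min \<tau> n y) x"
      define a' where "a' = int_iterate X1 T1 (drift_min \<tau> n y) x'"
      have aX: "a \<in> X1" "a' \<in> X1" using int_iterate_in[OF X1] in1 by (auto simp: a_def a'_def)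
      have "c (drift_width \<tau> n y) a = c (drift_width \<tau> n y) a'"
        using gz yx lo wd by (simp add: g_def a_def a'_def)
      then have ca: "dist ((T1 ^^ m) a) ((T1 ^^ m) a') \<le> \<delta>" if "m < drift_width \<tau> n y" for m
        using c[of "drift_width \<tau> n y"] aX that by auto
      have close: "dist (int_iterate X2 T2 (cocycle_sum \<tau> i u) v) (int_iterate X2 T2 (cocycle_sum \<tau> i u') v') \<le> \<eta> \<and>
          (\<forall>j\<in>{-int s..int s}. u (j + int i) = u' (j + int i))" if i: "i < n" for i
      proof -
        obtain m where m: "m < drift_width \<tau> n y" "cocycle_sum \<tau> i y = drift_min \<tau> n y + int m"
          using cocycle_sum_in_drift_hull[OF i] by blast
        have ceq: "cocycle_sum \<tau> i y' = cocycle_sum \<tau> i y"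
          using cocycle_sum_cong_window[OF Y s in1(1,2) win i] by simp
        have "int_iterate X1 T1 (cocycle_sum \<tau> i y) x = (T1 ^^ m) a"
          "int_iterate X1 T1 (cocycle_sum \<tau> i y') x' = (T1 ^^ m) a'"
          using int_iterate_add[OF X1 in1(3), of "int m" "drift_min \<tau> n y"]
            int_iterate_add[OF X1 in1(4), of "int m" "drift_min \<tau> n y"] m(2) ceq
          by (simp_all add: a_def a'_def int_iterate_of_nat add.commute)
        then have d: "dist (int_iterate X1 T1 (cocycle_sum \<tau> i y) x) (int_iterate X1 T1 (cocycle_sum \<tau> i y') x') \<le> \<delta>"
          using ca[OF m(1)] by simp
        have "\<forall>j\<in>{-int k..int k}. (shift ^^ i) y j = (shift ^^ i) y' j"
          unfolding shift_iterate using i by (intro ballI agree) auto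
        from unif[rule_format (no_asm), OF subshift_iterate_in[OF Y in1(1)] subshift_iterate_in[OF Y in1(2)]
            int_iterate_in[OF X1 in1(3)] int_iterate_in[OF X1 in1(4)] d this]
        have *: "dist (snd (\<pi> ((skew_product \<tau> X1 T1 ^^ i) z))) (snd (\<pi> ((skew_product \<tau> X1 T1 ^^ i) z'))) \<le> \<eta> \<and>
          (\<forall>j\<in>{-int s..int s}. fst (\<pi> ((skew_product \<tau> X1 T1 ^^ i) z)) j
            = fst (\<pi> ((skew_product \<tau> X1 T1 ^^ i) z')) j)"
          unfolding yx skew_product_iterate[OF X1 in1(3)] skew_product_iterate[OF X1 in1(4)] .
        then show ?thesis
          unfolding factor_map_iterate[OF \<pi> skew_in z] factor_map_iterate[OF \<pi> skew_in z'] uv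
            skew_product_iterate[OF X2 in2(1)] skew_product_iterate[OF X2 in2(2)]
          by (simp add: shift_iterate)
      qed
      \<comment> \<open>the windows of radius \<open>s\<close> around the times \<open>0, ..., n - 1\<close> cover the window of the word\<close>
      have "u j = u' j" if j: "j \<in> {- int s..int s + int n - 1}" for j
      proof (cases "j \<le> int s")
        case True
        then show ?thesis using close[OF n] j by auto
      next
        case False
        then obtain i where i: "i < n" "j = int s + int i"
          using j by (intro that[of "nat (j - int s)"]) auto
        then show ?thesis using close[OF i(1)] by auto
      qed
      then show ?thesis unfolding window_word_eq_iff uv using close by simp
    qed
    \<comment> \<open>\<open>h w\<close> pulls the labels back to \<open>X2\<close> along a section of the factor map over the word \<open>w\<close>; the iterate
        by \<open>- drift_min\<close> moves the hull to \<open>{0..<word_width}\<close>\<close>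
    define \<sigma> where "\<sigma> = inv_into (Y \<times> X1) \<pi>"
    have \<sigma>: "\<sigma> q \<in> Y \<times> X1" "\<pi> (\<sigma> q) = q" if "q \<in> Y \<times> X2" for q
      using that \<pi>im unfolding \<sigma>_def by (metis inv_into_into, metis f_inv_into_f)
    define q where "q w x = (word_rep n s Y w, int_iterate X2 T2 (- drift_min \<tau> n (word_rep n s Y w)) x)" for w x
    define h where "h w x = g (\<sigma> (q w x))" for w x
    have q: "q w x \<in> Y \<times> X2" if "w \<in> L" "x \<in> X2" for w x
      using that word_rep_in[of w n s Y] int_iterate_in[OF X2] by (auto simp: q_def L_def)
    have hB: "h w ` X2 \<subseteq> B" if "w \<in> L" for w
      unfolding h_def by (intro image_subsetI gB \<sigma>(1) q that)
    have lower: "spa X2 T2 {..<word_width \<tau> n s Y w} \<epsilon> \<le> card (h w ` X2)" if w: "w \<in> L" for w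
    proof (rule spa_le_card_labels)
      show "finite (h w ` X2)" using hB[OF w] finB by (rule finite_subset)
      fix x x' i assume x: "x \<in> X2" "x' \<in> X2" "h w x = h w x'" and i: "i \<in> {..<word_width \<tau> n s Y w}"
      define y where "y = word_rep n s Y w"
      define a where "a = drift_min \<tau> n y"
      have y: "y \<in> Y" using w word_rep_in unfolding y_def L_def by blast
      have "i < drift_width \<tau> n y" using i by (simp add: word_width_def y_def)
      then obtain m where m: "m < n" "\<bar>a + int i - cocycle_sum \<tau> m y\<bar> \<le> int K"
        using drift_hull_dense[OF n, of \<tau> y K i] K subshift_iterate_in[OF Y y] unfolding a_def by blast
      define j where "j = a + int i - cocycle_sum \<tau> m y"
      have j: "j \<in> {- int K..int K}" using m(2) by (auto simp: j_def)
      note q1 = q[OF w x(1)] and q2 = q[OF w x(2)]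
      have "dist (int_iterate X2 T2 (cocycle_sum \<tau> m y) (int_iterate X2 T2 (- a) x))
          (int_iterate X2 T2 (cocycle_sum \<tau> m y) (int_iterate X2 T2 (- a) x')) \<le> \<eta>"
        using same[OF \<sigma>(1)[OF q1] \<sigma>(1)[OF q2]] x(3) m(1) \<sigma>(2)[OF q1] \<sigma>(2)[OF q2]
        by (simp add: h_def q_def y_def a_def)
      from \<eta>(2)[OF j _ _ this] int_iterate_in[OF X2] x
      have *: "dist (int_iterate X2 T2 j (int_iterate X2 T2 (cocycle_sum \<tau> m y) (int_iterate X2 T2 (- a) x)))
        (int_iterate X2 T2 j (int_iterate X2 T2 (cocycle_sum \<tau> m y) (int_iterate X2 T2 (- a) x'))) \<le> \<epsilon>"
        by simp
      have "int_iterate X2 T2 j (int_iterate X2 T2 (cocycle_sum \<tau> m y) (int_iterate X2 T2 (- a) v)) = (T2 ^^ i) v"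
        if "v \<in> X2" for v
        using that int_iterate_in[OF X2] by (simp add: j_def int_iterate_of_nat flip: int_iterate_add[OF X2])
      then show "dist ((T2 ^^ i) x) ((T2 ^^ i) x') \<le> \<epsilon>" using * x by simp
    qed
    have disj: "h w ` X2 \<inter> h w' ` X2 = {}" if ww': "w \<in> L" "w' \<in> L" "w \<noteq> w'" for w w'
    proof (rule ccontr)
      assume "h w ` X2 \<inter> h w' ` X2 \<noteq> {}"
      then obtain x x' where x: "x \<in> X2" "x' \<in> X2" "h w x = h w' x'" by blast
      note q1 = q[OF ww'(1) x(1)] and q2 = q[OF ww'(2) x(2)]
      have "window_word n s (word_rep n s Y w) = window_word n s (word_rep n s Y w')"
        using same[OF \<sigma>(1)[OF q1] \<sigma>(1)[OF q2]] x(3) \<sigma>(2)[OF q1] \<sigma>(2)[OF q2]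
        by (simp add: h_def q_def)
      then show False using ww' by (simp add: L_def window_word_rep)
    qed
    have "(\<Sum>w\<in>L. spa X2 T2 {..<word_width \<tau> n s Y w} \<epsilon>) \<le> (\<Sum>w\<in>L. card (h w ` X2))"
      using lower by (rule sum_mono)
    also have "\<dots> = card (\<Union>w\<in>L. h w ` X2)"
      using finL finite_subset[OF hB finB] disj by (subst card_UN_disjoint) auto
    also have "\<dots> \<le> card B" using hB finB by (intro card_mono) auto
    finally show ?thesis unfolding cardB L_def .
  qed
  show ?thesis using main by (intro that[OF \<delta>2]) blast
qed


section \<open>Averaging over words\<close>

text \<open>If \<open>D1 / D2 \<rightarrow> 0\<close>, then words of large width contribute to \<open>C * D1\<close> at most half of what they
  contribute to \<open>D2\<close>, and the words of small width contribute a bounded amount each. Hence the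
  average of \<open>D2\<close> over the words stays bounded. But a positive proportion of the words has large
  width, where \<open>D2\<close> is large.\<close>

lemma average_comparison_contradiction:
  fixes width :: "nat \<Rightarrow> 'w \<Rightarrow> nat" and D1 D2 :: "nat \<Rightarrow> real"
  assumes fin: "\<And>n. finite (L n)" and ne: "\<And>n. L n \<noteq> {}"
    and compare: "\<And>n. n > 0 \<Longrightarrow> (\<Sum>w\<in>L n. D2 (width n w)) \<le> C * (\<Sum>w\<in>L n. D1 (width n w))"
    and nonneg: "\<And>m. D1 m \<ge> 0" "\<And>m. D2 m > 0" "C \<ge> 0"
    and wide: "\<And>N. \<forall>\<^sub>F n in sequentially. c * real (card (L n)) \<le> real (card {w \<in> L n. N \<le> width n w})"
    and c: "c > 0"
    and ratio: "(\<lambda>m. D1 m / D2 m) \<longlonglongrightarrow> 0"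
    and large: "filterlim D2 at_top sequentially"
  shows False
proof -
  have "(\<lambda>m. C * (D1 m / D2 m)) \<longlonglongrightarrow> C * 0" by (intro tendsto_intros ratio)
  then have "\<forall>\<^sub>F m in sequentially. C * (D1 m / D2 m) < 1 / 2" by (rule order_tendstoD(2)) simp
  then obtain N where N: "\<And>m. m \<ge> N \<Longrightarrow> C * (D1 m / D2 m) < 1 / 2"
    unfolding eventually_sequentially by blast
  define A where "A = C * (\<Sum>m<N. D1 m)"
  have A: "A \<ge> 0" unfolding A_def using nonneg by (intro mult_nonneg_nonneg sum_nonneg) auto
  have pointwise: "C * D1 m \<le> D2 m / 2 + A" for m
  proof (cases "m < N")
    case True
    then have "D1 m \<le> (\<Sum>m<N. D1 m)" using nonneg by (intro member_le_sum) auto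
    then have "C * D1 m \<le> A" unfolding A_def using nonneg(3) by (rule mult_left_mono)
    then show ?thesis using nonneg(2)[of m] by linarith
  next
    case False
    then have "C * (D1 m / D2 m) < 1 / 2" by (intro N) simp
    then have "C * D1 m < D2 m / 2" using nonneg(2)[of m] by (simp add: field_simps)
    then show ?thesis using A by linarith
  qed
  have bounded: "(\<Sum>w\<in>L n. D2 (width n w)) \<le> 2 * A * real (card (L n))" if "n > 0" for n
  proof -
    have "(\<Sum>w\<in>L n. D2 (width n w)) \<le> (\<Sum>w\<in>L n. C * D1 (width n w))"
      using compare[OF that] by (simp add: sum_distrib_left)
    also have "\<dots> \<le> (\<Sum>w\<in>L n. D2 (width n w) / 2 + A)" by (intro sum_mono pointwise)
    also have "\<dots> = (\<Sum>w\<in>L n. D2 (width n w)) / 2 + real (card (L n)) * A"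
      by (simp add: sum.distrib sum_divide_distrib)
    finally show ?thesis by (simp add: algebra_simps)
  qed
  \<comment> \<open>a proportion \<open>c\<close> of words with \<open>D2\<close> at least \<open>b\<close> alone pushes the average above \<open>2 * A\<close>\<close>
  define b where "b = 2 * A / c + 1"
  have "b > 0" unfolding b_def using A c by (intro add_nonneg_pos divide_nonneg_pos) auto
  moreover have "c * b = 2 * A + c" using c by (simp add: b_def field_simps)
  ultimately have b: "b > 0" "c * b > 2 * A" using c by auto
  obtain M where M: "\<And>m. m \<ge> M \<Longrightarrow> D2 m \<ge> b"
    using large unfolding filterlim_at_top eventually_sequentially by blast
  obtain n where n: "n > 0" "c * real (card (L n)) \<le> real (card {w \<in> L n. M \<le> width n w})"
    using eventually_conj[OF wide[of M] eventually_gt_at_top[of 0]]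
    by (auto simp: eventually_sequentially)
  have "2 * A * real (card (L n)) < c * b * real (card (L n))"
    using b fin ne by (intro mult_strict_right_mono) (auto simp: card_gt_0_iff)
  also have "\<dots> \<le> b * real (card {w \<in> L n. M \<le> width n w})"
    using mult_left_mono[OF n(2), of b] b(1) by (simp add: mult_ac)
  also have "\<dots> = (\<Sum>w\<in>{w \<in> L n. M \<le> width n w}. b)" by simp
  also have "\<dots> \<le> (\<Sum>w\<in>{w \<in> L n. M \<le> width n w}. D2 (width n w))"
    using M by (intro sum_mono) auto
  also have "\<dots> \<le> (\<Sum>w\<in>L n. D2 (width n w))"
    using fin nonneg(2) by (intro sum_mono2) (auto intro: less_imp_le)
  also have "\<dots> \<le> 2 * A * real (card (L n))" by (rule bounded[OF n(1)])
  finally show False by simp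
qed

text \<open>The constant drops from \<open>lam\<close> to \<open>lam / 2\<close> because a limit inferior that is at least \<open>lam\<close> only
  bounds the terms eventually by numbers less than \<open>lam\<close>.\<close>

lemma cocycle_unbounded_width:
  fixes Y :: "(int \<Rightarrow> 'a::finite) set"
  assumes "Y \<noteq> {}" "lam > 0" "cocycle_unbounded lam Y \<tau>"
  obtains s where "determined_by_window Y \<tau> s"
    "\<forall>N. \<forall>\<^sub>F n in sequentially. lam / 2 * real (card (language n s Y))
      \<le> real (card {w \<in> language n s Y. N \<le> word_width \<tau> n s Y w})"
proof -
  obtain s where s: "determined_by_window Y \<tau> s"
    and lim: "\<And>N. ereal lam \<le> liminf (\<lambda>n. ereal (real (card {w \<in> language n s Y. word_range \<tau> n s Y w \<ge> N}) /
      real (card (language n s Y))))"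
    using assms(3) unfolding cocycle_unbounded_def by blast
  have "\<forall>\<^sub>F n in sequentially. lam / 2 * real (card (language n s Y))
      \<le> real (card {w \<in> language n s Y. N \<le> word_width \<tau> n s Y w})" for N
  proof -
    have "ereal (lam / 2) < ereal lam" using assms(2) by simp
    then have "\<forall>\<^sub>F n in sequentially. ereal (lam / 2) <
        ereal (real (card {w \<in> language n s Y. word_range \<tau> n s Y w \<ge> N}) / real (card (language n s Y)))"
      using lim[of N] by (intro less_LiminfD) (rule less_le_trans)
    then show ?thesis
    proof eventually_elim
      case (elim n)
      have "language n s Y \<noteq> {}" using assms(1) by (simp add: language_def)
      then have pos: "real (card (language n s Y)) > 0"
        using finite_language[of n s Y] by (simp add: card_gt_0_iff)
      have "lam / 2 * real (card (language n s Y)) < real (card {w \<in> language n s Y. word_range \<tau> n s Y w \<ge> N})"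
        using elim pos by (simp add: less_divide_eq)
      also have "card {w \<in> language n s Y. word_range \<tau> n s Y w \<ge> N}
          \<le> card {w \<in> language n s Y. N \<le> word_width \<tau> n s Y w}"
        using finite_language[of n s Y] word_range_le_word_width[of \<tau> n s Y]
        by (intro card_mono) (auto intro: order_trans)
      finally show ?case by simp
    qed
  qed
  then show ?thesis by (intro that[OF s]) blast
qed

text \<open>If the inequality failed, a parameter \<open>t\<close> between the two entropies would make \<open>b n t\<close> grow
  strictly faster than the spanning numbers of \<open>T1\<close> at every radius, but at most as fast, up to a
  constant, as those of \<open>T2\<close> at a small radius. Comparison along the words excludes this.\<close>

lemma lower_ent_le_upper_ent_of_skew_factor:
  fixes Y :: "(int \<Rightarrow> 'a::{finite,discrete_topology}) set"
    and X1 :: "'x1::metric_space set" and X2 :: "'x2::metric_space set"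
  assumes Y: "subshift Y" and \<tau>: "continuous_on Y \<tau>"
    and lam: "lam > 0" and unb: "cocycle_unbounded lam Y \<tau>"
    and X1: "invertible_tds X1 T1" and X2: "invertible_tds X2 T2"
    and \<pi>: "factor_map (Y \<times> X1) (skew_product \<tau> X1 T1) (Y \<times> X2) (skew_product \<tau> X2 T2) \<pi>"
    and b: "scale b"
  shows "lower_ent b X2 T2 \<le> upper_ent b X1 T1"
proof (rule ccontr)
  note tds1 = invertible_tds_tds[OF X1] and tds2 = invertible_tds_tds[OF X2]
  assume "\<not> ?thesis"
  then obtain t where t: "upper_ent b X1 T1 < ereal t" "ereal t < lower_ent b X2 T2"
    by (auto simp: not_le dest: ereal_dense2)
  have upper: "upper_ent_at b X1 T1 \<delta> < ereal t" if "\<delta> > 0" for \<delta>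
    using t(1) that unfolding upper_ent_eq_SUP[OF tds1 b]
    by (meson SUP_upper greaterThan_iff le_less_trans)
  have "0 \<le> upper_ent_at b X1 T1 1" unfolding upper_ent_at_def by (intro Sup_upper) auto
  also have "\<dots> < ereal t" by (rule upper) simp
  finally have "0 < ereal t" .
  then have t0: "t > 0" by simp
  have bpos: "b n r > 0" if "r > 0" for n r using b that by (simp add: scale_def)
  obtain \<epsilon> where \<epsilon>: "\<epsilon> > 0" "ereal t < lower_ent_at b X2 T2 \<epsilon>"
    using t(2) unfolding lower_ent_eq_SUP[OF tds2 b] by (auto simp: less_SUP_iff)
  then obtain t' where t': "t < t'" "0 < liminf (\<lambda>n. ereal (real (spa X2 T2 {..<n} \<epsilon>) / b n t'))"
    using t0 unfolding lower_ent_at_def less_Sup_iff by auto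
  obtain c where c: "0 < c" "ereal c < liminf (\<lambda>n. ereal (real (spa X2 T2 {..<n} \<epsilon>) / b n t'))"
    using ereal_dense2[OF t'(2)] by auto
  have "\<forall>\<^sub>F n in sequentially. c < real (spa X2 T2 {..<n} \<epsilon>) / b n t'"
    using less_LiminfD[OF c(2)] by simp
  then have ge: "\<forall>\<^sub>F n in sequentially. c * b n t \<le> real (spa X2 T2 {..<n} \<epsilon>)"
  proof eventually_elim
    case (elim n)
    have "b n t \<le> b n t'" using b t0 t'(1) by (auto simp: scale_def mono_on_def)
    then have "c * b n t \<le> c * b n t'" using c(1) by simp
    also have "\<dots> \<le> real (spa X2 T2 {..<n} \<epsilon>)"
      using elim bpos[of t' n] t0 t'(1) by (simp add: less_divide_eq)
    finally show ?case .
  qed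
  obtain s where s: "determined_by_window Y \<tau> s"
    and wide: "\<forall>N. \<forall>\<^sub>F n in sequentially. lam / 2 * real (card (language n s Y))
      \<le> real (card {w \<in> language n s Y. N \<le> word_width \<tau> n s Y w})"
    by (rule cocycle_unbounded_width[OF _ lam unb]) (use Y in \<open>auto simp: subshift_def\<close>)
  obtain \<delta> C where \<delta>: "\<delta> > 0" and compare: "\<forall>n>0.
      (\<Sum>w\<in>language n s Y. spa X2 T2 {..<word_width \<tau> n s Y w} \<epsilon>)
      \<le> C * (\<Sum>w\<in>language n s Y. spa X1 T1 {..<word_width \<tau> n s Y w} \<delta>)"
    by (rule sum_spa_comparison[OF Y \<tau> s X1 X2 \<pi> \<epsilon>(1)])
  let ?D1 = "\<lambda>m. real (spa X1 T1 {..<m} \<delta>)" and ?D2 = "\<lambda>m. real (spa X2 T2 {..<m} \<epsilon>)"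
  have small: "(\<lambda>m. ?D1 m / b m t) \<longlonglongrightarrow> 0"
  proof -
    have "\<not> limsup (\<lambda>m. ereal (?D1 m / b m t)) > 0"
    proof
      assume "limsup (\<lambda>m. ereal (?D1 m / b m t)) > 0"
      then have "ereal t \<le> upper_ent_at b X1 T1 \<delta>"
        unfolding upper_ent_at_def using t0 by (intro Sup_upper) auto
      then show False using upper[OF \<delta>] by simp
    qed
    then have "limsup (\<lambda>m. ereal (?D1 m / b m t)) \<le> 0" by simp
    moreover have "0 \<le> liminf (\<lambda>m. ereal (?D1 m / b m t))"
      by (intro Liminf_bounded always_eventually allI)
         (auto intro!: divide_nonneg_pos bpos t0)
    ultimately show ?thesis unfolding zero_ereal_def by (rule limsup_le_liminf_real)
  qed
  show False
  proof (rule average_comparison_contradiction[of "\<lambda>n. language n s Y" ?D2 "\<lambda>n. word_width \<tau> n s Y" "real C" ?D1 "lam / 2"])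
    show "finite (language n s Y)" for n by (rule finite_language)
    show "language n s Y \<noteq> {}" for n using Y by (simp add: language_def subshift_def)
    show "(\<Sum>w\<in>language n s Y. ?D2 (word_width \<tau> n s Y w))
        \<le> real C * (\<Sum>w\<in>language n s Y. ?D1 (word_width \<tau> n s Y w))" if "n > 0" for n
      using compare[rule_format, OF that] by (simp flip: of_nat_sum of_nat_mult)
    show D2: "?D2 m > 0" for m using spa_pos[OF tds2 finite_lessThan \<epsilon>(1)] by simp
    show "\<forall>\<^sub>F n in sequentially. lam / 2 * real (card (language n s Y))
      \<le> real (card {w \<in> language n s Y. N \<le> word_width \<tau> n s Y w})" for N
      using wide by blast
    have bt: "filterlim (\<lambda>n. b n t) at_top sequentially" using b t0 by (simp add: scale_def)
    have "filterlim (\<lambda>n. c * b n t) at_top sequentially"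
      using c(1) bt by (intro filterlim_tendsto_pos_mult_at_top[of _ c] tendsto_const) auto
    then show "filterlim ?D2 at_top sequentially" using ge by (rule filterlim_at_top_mono)
    have "(\<lambda>m. ?D1 m / b m t / c) \<longlonglongrightarrow> 0 / c" using small by (intro tendsto_intros) (use c(1) in auto)
    then have lim0: "(\<lambda>m. ?D1 m / b m t / c) \<longlonglongrightarrow> 0" by simp
    show "(\<lambda>m. ?D1 m / ?D2 m) \<longlonglongrightarrow> 0"
    proof (rule tendsto_sandwich[OF _ _ tendsto_const lim0])
      show "\<forall>\<^sub>F m in sequentially. ?D1 m / ?D2 m \<le> ?D1 m / b m t / c"
        using ge
      proof eventually_elim
        case (elim m)
        have "?D1 m / ?D2 m \<le> ?D1 m / (c * b m t)"
          using elim c(1) bpos[OF t0, of m] D2[of m] by (intro divide_left_mono mult_pos_pos) simp_all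
        then show ?case by (simp add: mult.commute)
      qed
    qed simp
  qed (use lam in auto)
qed

theorem corollary1p5:
  fixes Y :: "(int \<Rightarrow> 'a::{finite,discrete_topology}) set"
    and \<tau> :: "(int \<Rightarrow> 'a) \<Rightarrow> int"
    and lam :: real
    and X1 :: "'x1::metric_space set" and T1 :: "'x1 \<Rightarrow> 'x1"
    and X2 :: "'x2::metric_space set" and T2 :: "'x2 \<Rightarrow> 'x2"
  assumes "subshift Y"
    and "continuous_on Y \<tau>"
    and "lam > 0" and "cocycle_unbounded lam Y \<tau>"
    and "invertible_tds X1 T1" and "invertible_tds X2 T2"
    and "\<exists>\<pi>. factor_map (Y \<times> X1) (skew_product \<tau> X1 T1) (Y \<times> X2) (skew_product \<tau> X2 T2) \<pi>"
  shows "h_top X1 T1 \<ge> h_top X2 T2 \<and>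
    ((\<forall>y\<in>Y. \<tau> y \<in> {-1, 0, 1}) \<longrightarrow>
      (\<forall>b. scale b \<longrightarrow> upper_ent b X1 T1 \<ge> lower_ent b X2 T2))"
proof -
  have ent: "lower_ent b X2 T2 \<le> upper_ent b X1 T1" if "scale b" for b
    using assms that by (blast intro: lower_ent_le_upper_ent_of_skew_factor)
  have "h_top X2 T2 \<le> lower_ent exp_scale X2 T2"
    using assms(6) by (intro h_top_le_lower_ent_exp_scale invertible_tds_tds)
  also have "\<dots> \<le> upper_ent exp_scale X1 T1" by (rule ent[OF scale_exp_scale])
  also have "\<dots> \<le> h_top X1 T1"
    using assms(5) by (intro upper_ent_exp_scale_le_h_top invertible_tds_tds)
  finally show ?thesis using ent by blast
qed

end
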